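(* Let $\mathbb{F}$ be an infinite non-Pythagorean field, and let $n \geq 1$ be an integer. Then every optimal weakly triangularizable subspace of $\mathrm{M}_n(\mathbb{F})$ is conjugated to $\mathrm{T}_n(\mathbb{F})$, i.e. equals $P\,\mathrm{T}_n(\mathbb{F})P^{-1}$ for some $P\in\mathrm{GL}_n(\mathbb{F})$.
   Context: A field $\mathbb{F}$ is Pythagorean if the sum of two squares in $\mathbb{F}$ is always a square in $\mathbb{F}$. $\mathrm{M}_n(\mathbb{F})$ is the space of $n\times n$ matrices over $\mathbb{F}$ and $\mathrm{T}_n(\mathbb{F})$ its subspace of all upper-triangular matrices. A linear subspace of $\mathrm{M}_n(\mathbb{F})$ is weakly triangularizable when all its elements are triangularizable over $\mathbb{F}$ (similar over $\mathbb{F}$ to an upper-triangular matrix). $t_n(\mathbb{F})$ is the greatest possible dimension of a weakly triangularizable linear subspace of $\mathrm{M}_n(\mathbb{F})$; such a subspace is optimal when its dimension equals $t_n(\mathbb{F})$. *)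

theory Defs
  imports "Jordan_Normal_Form.VS_Connect"
begin

definition pythagorean :: "'a::field itself \<Rightarrow> bool" where
  "pythagorean _ \<longleftrightarrow> (\<forall>a b :: 'a. \<exists>c. a^2 + b^2 = c^2)"

definition T_mat :: "nat \<Rightarrow> 'a::field mat set" where
  "T_mat n = {A \<in> carrier_mat n n. upper_triangular A}"

definition triangularizable :: "'a::field mat \<Rightarrow> bool" where
  "triangularizable A \<longleftrightarrow> (\<exists>B. upper_triangular B \<and> similar_mat A B)"

definition mat_subspace :: "nat \<Rightarrow> 'a::field mat set \<Rightarrow> bool" where
  "mat_subspace n W \<longleftrightarrow> VectorSpace.subspace class_ring W (module_mat TYPE('a) n n)"

text \<open>\<open>vectorspace.dim\<close> is the least size of a finite generating set; this is the usual dimension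
  because \<open>n \<times> n\<close> matrices form a finite-dimensional space (\<open>fin_dim_mat\<close> below).\<close>
definition mat_subspace_dim :: "nat \<Rightarrow> 'a::field mat set \<Rightarrow> nat" where
  "mat_subspace_dim n W =
     vectorspace.dim (class_ring :: 'a ring) ((module_mat TYPE('a) n n)\<lparr>carrier := W\<rparr>)"

definition weakly_triangularizable :: "nat \<Rightarrow> 'a::field mat set \<Rightarrow> bool" where
  "weakly_triangularizable n W \<longleftrightarrow> mat_subspace n W \<and> (\<forall>A\<in>W. triangularizable A)"

text \<open>The number \<open>t\<^sub>n\<close> of the field \<open>'a\<close>. The maximum exists, see \<open>t_dim_attained\<close> and
  \<open>t_dim_upper\<close> below.\<close>
definition t_dim :: "'a::field itself \<Rightarrow> nat \<Rightarrow> nat" where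
  "t_dim _ n = (GREATEST d. \<exists>W :: 'a mat set.
     weakly_triangularizable n W \<and> mat_subspace_dim n W = d)"

definition optimal :: "nat \<Rightarrow> 'a::field mat set \<Rightarrow> bool" where
  "optimal n W \<longleftrightarrow>
     weakly_triangularizable n W \<and> mat_subspace_dim n W = t_dim TYPE('a) n"

definition conjugated :: "nat \<Rightarrow> 'a::field mat set \<Rightarrow> 'a mat set \<Rightarrow> bool" where
  "conjugated n W W' \<longleftrightarrow> (\<exists>P Q. P \<in> carrier_mat n n \<and> Q \<in> carrier_mat n n \<and>
     P * Q = 1\<^sub>m n \<and> Q * P = 1\<^sub>m n \<and> W = (\<lambda>A. P * A * Q) ` W')"

lemma fin_dim_mat:
  "vectorspace.fin_dim (class_ring :: 'a::field ring) (module_mat TYPE('a) n n)"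
proof -
  let ?V = "module_mat TYPE('a) n n"
  interpret V: vectorspace "class_ring :: 'a ring" ?V by (rule matrix_vs)
  define E where "E = (\<lambda>p. mat n n (\<lambda>q. if q = p then 1 else 0 :: 'a))"
  define I where "I = {..<n} \<times> {..<n}"
  have fin: "finite (E ` I)" by (simp add: I_def)
  have sub: "E ` I \<subseteq> carrier ?V" by (auto simp: module_mat_simps E_def)
  interpret S: submodule "class_ring :: 'a ring" "V.span (E ` I)" ?V
    by (rule V.span_is_submodule[OF sub])
  have *: "mat n n (\<lambda>q. if q \<in> J then M $$ q else 0) \<in> V.span (E ` I)"
    if "finite J" "J \<subseteq> I" for J M
    using that
  proof (induction J rule: finite_induct)
    case empty
    have "mat n n (\<lambda>q. 0 :: 'a) = 0\<^sub>m n n" by (auto simp: zero_mat_def)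
    then show ?case using S.zero_closed by (simp add: module_mat_simps)
  next
    case (insert p J)
    have "mat n n (\<lambda>q. if q \<in> insert p J then M $$ q else 0) =
        M $$ p \<cdot>\<^sub>m E p + mat n n (\<lambda>q. if q \<in> J then M $$ q else 0)"
      using insert.hyps by (intro eq_matI) (auto simp: E_def)
    moreover have "E p \<in> V.span (E ` I)"
      using V.in_own_span[OF sub] insert.prems by auto
    ultimately show ?case
      using S.m_closed[OF S.smult_closed[of "M $$ p" "E p"]] insert
      by (simp add: module_mat_simps)
  qed
  have "M \<in> V.span (E ` I)" if "M \<in> carrier_mat n n" for M
  proof -
    have "mat n n (\<lambda>q. if q \<in> I then M $$ q else 0) = M"
      using that by (intro eq_matI) (auto simp: I_def)
    then show ?thesis using *[of I M] by (simp add: I_def)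
  qed
  then have "V.span (E ` I) = carrier ?V"
    using V.span_is_subset2[OF sub] by (auto simp: module_mat_simps)
  then show ?thesis unfolding V.fin_dim_def using fin sub by blast
qed

lemma mat_subspace_dim_le:
  fixes W :: "'a::field mat set"
  assumes "mat_subspace n W"
  shows "mat_subspace_dim n W \<le> vectorspace.dim (class_ring :: 'a ring) (module_mat TYPE('a) n n)"
proof -
  let ?V = "module_mat TYPE('a) n n"
  interpret V: vectorspace "class_ring :: 'a ring" ?V by (rule matrix_vs)
  have sub: "VectorSpace.subspace class_ring W ?V"
    using assms by (simp add: mat_subspace_def)
  then have subm: "submodule class_ring W ?V" by simp
  interpret W: vectorspace "class_ring :: 'a ring" "?V\<lparr>carrier := W\<rparr>"
    by (rule V.subspace_is_vs[OF sub])
  have W: "W \<subseteq> carrier ?V" using subm by (simp add: submodule_def)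
  have bound: "finite A \<and> card A \<le> V.dim"
    if "A \<subseteq> carrier (?V\<lparr>carrier := W\<rparr>) \<and> W.lin_indpt A" for A
    using that V.li_le_dim[OF fin_dim_mat] V.span_li_not_depend(2)[OF _ subm, of A] W by auto
  have "W.lin_indpt {}" by (auto simp: W.lin_dep_def)
  then obtain A where A: "finite A"
    "maximal A (\<lambda>S. S \<subseteq> carrier (?V\<lparr>carrier := W\<rparr>) \<and> W.lin_indpt S)"
    using maximal_exists[where B = "{}" and N = V.dim and
        P = "\<lambda>S. S \<subseteq> carrier (?V\<lparr>carrier := W\<rparr>) \<and> W.lin_indpt S"] bound by auto
  have "W.dim = card A"
    by (rule W.dim_basis[OF A(1) W.max_li_is_basis[OF A(2)]])
  moreover have "card A \<le> V.dim" using A(2) bound by (auto simp: maximal_def)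
  ultimately show ?thesis by (simp add: mat_subspace_dim_def)
qed

lemma weakly_triangularizable_zero: "weakly_triangularizable n {0\<^sub>m n n :: 'a::field mat}"
proof -
  have "triangularizable (0\<^sub>m n n :: 'a mat)"
    unfolding triangularizable_def
    by (rule exI[of _ "0\<^sub>m n n"]) (auto intro!: similar_mat_refl[of _ n])
  moreover have "mat_subspace n {0\<^sub>m n n :: 'a mat}"
    unfolding mat_subspace_def subspace_def submodule_def
    using matrix_vs[of n n, where 'a = 'a]
    by (auto simp: vectorspace_def module_mat_simps)
  ultimately show ?thesis by (simp add: weakly_triangularizable_def)
qed

lemma t_dim_upper:
  fixes W :: "'a::field mat set"
  assumes "weakly_triangularizable n W"
  shows "mat_subspace_dim n W \<le> t_dim TYPE('a) n"
  unfolding t_dim_def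
  by (rule Greatest_le_nat[where b = "vectorspace.dim (class_ring :: 'a ring) (module_mat TYPE('a) n n)"])
    (use assms mat_subspace_dim_le in \<open>auto simp: weakly_triangularizable_def\<close>)

lemma t_dim_attained:
  "\<exists>W :: 'a::field mat set. weakly_triangularizable n W \<and> mat_subspace_dim n W = t_dim TYPE('a) n"
  unfolding t_dim_def
  by (rule GreatestI_nat[where b = "vectorspace.dim (class_ring :: 'a ring) (module_mat TYPE('a) n n)"
        and k = "mat_subspace_dim n {0\<^sub>m n n :: 'a mat}"])
    (use weakly_triangularizable_zero mat_subspace_dim_le in
      \<open>auto simp: weakly_triangularizable_def\<close>)

end

theory Submission
  imports Defs
begin

text \<open>The proof looks at the matrices of rank one in a space \<open>W\<close> of triangularizable matrices. Write
\<open>x \<otimes> \<phi>\<close> for the matrix \<open>v \<mapsto> \<phi>(v) x\<close>. Triangularizability enters only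
through one consequence, \<open>quad_free\<close>: no \<open>(A - \<mu>)\<^sup>2\<close> has an eigenvalue that is a nonsquare.
This property passes to quotients by an eigenvector and to invariant subspaces without any talk of
characteristic polynomials. If \<open>x \<otimes> \<phi>\<close> and \<open>y \<otimes> \<psi>\<close> lie in \<open>W\<close>, then
\<open>x\<close> is an eigenvector of the square of a shift of \<open>s (x \<otimes> \<phi>) + t (y \<otimes> \<psi>)\<close>, and
its eigenvalue is a binary quadratic form in \<open>s\<close> and \<open>t\<close>. Over a non-Pythagorean field every
nondegenerate such form has a nonsquare value, which gives (\<open>rank_one_pair\<close>)
\<open>\<phi>(y) \<psi>(x) = 0\<close> or \<open>\<phi>(y) \<psi>(x) = \<phi>(x) \<psi>(y)\<close>.

Call \<open>x\<close> good if \<open>W\<close> contains no nonzero \<open>x \<otimes> \<phi>\<close> with \<open>\<phi>(x) = 0\<close>. Among vectors in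
general position only few are bad: by \<open>rank_one_pair\<close>, two bad vectors \<open>x\<close>, \<open>y\<close> satisfy
\<open>\<phi>(y) = 0\<close> or \<open>\<psi>(x) = 0\<close>, whereas the kernel of \<open>\<phi>\<close> contains fewer than \<open>n\<close> of the
vectors. The moment curve therefore has only finitely many bad points. The matrices of \<open>W\<close> that
fix the line of a good \<open>x\<close> act on the quotient by \<open>x\<close>. The quotient, the values at \<open>x\<close>, and
the at most one-dimensional space of \<open>x \<otimes> \<phi>\<close> in \<open>W\<close> account for all of \<open>W\<close>, so induction gives
\<open>dim W \<le> n (n + 1) / 2\<close>.

Now suppose that equality holds. The same count shows that for every \<open>y \<noteq> 0\<close> some nonzero
\<open>y \<otimes> \<psi>\<close> lies in \<open>W\<close>. Fix a good \<open>x\<close> and \<open>\<phi>\<close> with \<open>\<phi>(x) = 1\<close> and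
\<open>x \<otimes> \<phi> \<in> W\<close>, and let \<open>c\<close> be in the kernel of \<open>\<phi>\<close>, with good image in the quotient by
\<open>x\<close>. For three points \<open>y = x + l c\<close> the pair lemma leaves two possible shapes of \<open>\<psi>\<close>, so two of
the points share a shape. As \<open>c\<close> is good in the quotient, these two points have the same \<open>\<psi>\<close> up to
scaling; then \<open>c \<otimes> \<psi>\<close> and \<open>x \<otimes> \<psi>\<close> lie in \<open>W\<close>, and as \<open>x\<close> is good, \<open>\<psi>\<close> is a multiple of \<open>\<phi>\<close>. Such \<open>c\<close> span
the kernel of \<open>\<phi>\<close>, hence \<open>W\<close> contains \<open>v \<otimes> \<phi>\<close> for all \<open>v\<close>. This forces every matrix of
\<open>W\<close> to preserve the kernel of \<open>\<phi>\<close>: otherwise a suitable \<open>v \<otimes> \<phi>\<close> added to it creates a plane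
on which the square of the matrix is a nonsquare scalar. Restricting to this hyperplane and using
induction yields a flag that is invariant under \<open>W\<close>.\<close>

section \<open>Sums of two squares and binary quadratic forms\<close>

lemma non_pythagorean_two_neq_0:
  assumes "\<not> pythagorean TYPE('a::field)"
  shows "(2::'a) \<noteq> 0"
proof
  assume two: "(2::'a) = 0"
  have "a^2 + b^2 = (a + b)^2" for a b :: 'a
    using two by (simp add: power2_sum)
  then show False using assms unfolding pythagorean_def by blast
qed

lemma non_pythagorean_nonsquare:
  assumes "\<not> pythagorean TYPE('a::field)"
  obtains d :: "'a::field" where "\<And>e. e^2 \<noteq> d"
proof -
  from assms obtain a b :: 'a where "\<And>c. a^2 + b^2 \<noteq> c^2"
    unfolding pythagorean_def by blast
  then have "\<And>e. e^2 \<noteq> a^2 + b^2" by metis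
  then show thesis by (rule that)
qed

text \<open>Up to a factor \<open>4\<close> this is the form \<open>(s p - t q)\<^sup>2 + 4 c s t\<close>. If it is nondegenerate and takes
only square values, then it is equivalent to \<open>X\<^sup>2 + Y\<^sup>2\<close>, because completing the square
exhibits its second coefficient as one of its values. If \<open>p\<close> or \<open>q\<close> vanishes, the form is linear in
one variable and takes every value.\<close>
lemma binary_form_nonsquare_value:
  fixes c p q :: "'a::field"
  assumes np: "\<not> pythagorean TYPE('a)" and c: "c \<noteq> 0" "c \<noteq> p * q"
  shows "\<exists>s t. \<forall>e. e^2 \<noteq> ((s * p - t * q) / 2)^2 + s * t * c"
proof (rule ccontr)
  assume "\<not> ?thesis"
  then have sq: "\<exists>e. e^2 = ((s * p - t * q) / 2)^2 + s * t * c" for s t by blast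
  have two: "(2::'a) \<noteq> 0" by (rule non_pythagorean_two_neq_0[OF np])
  obtain d :: 'a where d: "\<And>e. e^2 \<noteq> d" by (rule non_pythagorean_nonsquare[OF np]) blast
  have p0: "p \<noteq> 0"
  proof
    assume "p = 0"
    moreover obtain e where "e^2 = (((d - (q/2)^2) / c * p - 1 * q) / 2)^2 + (d - (q/2)^2) / c * 1 * c"
      using sq by blast
    ultimately have "e^2 = d" using c(1) by simp
    then show False using d by blast
  qed
  have q0: "q \<noteq> 0"
  proof
    assume "q = 0"
    moreover obtain e where "e^2 = ((1 * p - (d - (p/2)^2) / c * q) / 2)^2 + 1 * ((d - (p/2)^2) / c) * c"
      using sq by blast
    ultimately have "e^2 = d" using c(1) by simp
    then show False using d by blast
  qed
  define c' where "c' = c / (p * q)"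
  define D where "D = c' * (1 - c')"
  have c'c: "c = c' * p * q" using p0 q0 by (simp add: c'_def)
  have "D \<noteq> 0" using c p0 q0 by (simp add: D_def c'_def)
  \<comment> \<open>Completing the square turns the form into \<open>X\<^sup>2 + D T\<^sup>2\<close>.\<close>
  have form: "\<exists>e. e^2 = X^2 + D * T^2" for X T
  proof -
    define S where "S = 2 * X + (1 - 2 * c') * T"
    have "((S / p * p - T / q * q) / 2)^2 + S / p * (T / q) * c = ((S - T) / 2)^2 + S * T * c'"
      using p0 q0 by (simp add: c'c)
    also have "(S - T) / 2 = X - c' * T"
      using two by (simp add: S_def field_simps)
    also have "(X - c' * T)^2 + S * T * c' = X^2 + D * T^2"
      by (simp add: S_def D_def algebra_simps power2_eq_square)
    finally show ?thesis using sq[of "S / p" "T / q"] by simp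
  qed
  obtain \<delta> where \<delta>: "\<delta>^2 = D" using form[of 0 1] by auto
  with \<open>D \<noteq> 0\<close> have "\<delta> \<noteq> 0" by auto
  have "\<exists>e. a^2 + b^2 = e^2" for a b :: 'a
  proof -
    obtain e where "e^2 = a^2 + D * (b / \<delta>)^2" using form by blast
    also have "D * (b / \<delta>)^2 = b^2" using \<open>\<delta> \<noteq> 0\<close> by (simp add: \<delta>[symmetric] power_divide)
    finally show ?thesis by metis
  qed
  with np show False unfolding pythagorean_def by blast
qed

section \<open>Matrices without irreducible quadratic behaviour\<close>

text \<open>An \<open>n \<times> n\<close> matrix is a function of two indices of which only the values below \<open>n\<close> matter, and
likewise for vectors. This makes passing between sizes \<open>n\<close> and \<open>Suc n\<close> a matter of splitting off
the last summand.\<close>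
definition mv :: "nat \<Rightarrow> (nat \<Rightarrow> nat \<Rightarrow> 'a::field) \<Rightarrow> (nat \<Rightarrow> 'a) \<Rightarrow> nat \<Rightarrow> 'a" where
  "mv n A v i = (\<Sum>j<n. A i j * v j)"

definition dot :: "nat \<Rightarrow> (nat \<Rightarrow> 'a::field) \<Rightarrow> (nat \<Rightarrow> 'a) \<Rightarrow> 'a" where
  "dot n \<phi> v = (\<Sum>j<n. \<phi> j * v j)"

definition outer :: "(nat \<Rightarrow> 'a::field) \<Rightarrow> (nat \<Rightarrow> 'a) \<Rightarrow> nat \<Rightarrow> nat \<Rightarrow> 'a" where
  "outer x \<phi> i j = x i * \<phi> j"

definition lin2 :: "'a::field \<Rightarrow> (nat \<Rightarrow> nat \<Rightarrow> 'a) \<Rightarrow> 'a \<Rightarrow> (nat \<Rightarrow> nat \<Rightarrow> 'a) \<Rightarrow> nat \<Rightarrow> nat \<Rightarrow> 'a" where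
  "lin2 s A t B i j = s * A i j + t * B i j"

text \<open>The conditions say \<open>k = (A - \<mu>) h\<close> and \<open>(A - \<mu>)\<^sup>2 h = d h\<close>. With \<open>h \<noteq> 0\<close> this would make
the irreducible polynomial \<open>(X - \<mu>)\<^sup>2 - d\<close> a factor of the minimal polynomial of \<open>A\<close>.\<close>
definition quad_free :: "nat \<Rightarrow> (nat \<Rightarrow> nat \<Rightarrow> 'a::field) \<Rightarrow> bool" where
  "quad_free n A \<longleftrightarrow> (\<forall>\<mu> d h k. (\<forall>e. e^2 \<noteq> d) \<longrightarrow>
     (\<forall>i<n. mv n A h i = \<mu> * h i + k i) \<longrightarrow> (\<forall>i<n. mv n A k i = \<mu> * k i + d * h i) \<longrightarrow>
     (\<forall>i<n. h i = 0))"

text \<open>The second condition frees membership from the irrelevant entries, so that matrices need to be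
compared only at indices below \<open>n\<close>.\<close>
definition mspace :: "nat \<Rightarrow> (nat \<Rightarrow> nat \<Rightarrow> 'a::field) set \<Rightarrow> bool" where
  "mspace n W \<longleftrightarrow> (\<forall>A\<in>W. \<forall>B\<in>W. \<forall>s t. lin2 s A t B \<in> W) \<and>
     (\<forall>A\<in>W. \<forall>B. (\<forall>i<n. \<forall>j<n. B i j = A i j) \<longrightarrow> B \<in> W)"

definition qf_space :: "nat \<Rightarrow> (nat \<Rightarrow> nat \<Rightarrow> 'a::field) set \<Rightarrow> bool" where
  "qf_space n W \<longleftrightarrow> mspace n W \<and> (\<forall>A\<in>W. quad_free n A)"

text \<open>The matrix \<open>outer x \<phi>\<close> has trace \<open>\<phi>(x)\<close>, so a good vector spans the image of no nilpotent
matrix of rank one in \<open>W\<close>.\<close>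
definition good :: "nat \<Rightarrow> (nat \<Rightarrow> nat \<Rightarrow> 'a::field) set \<Rightarrow> (nat \<Rightarrow> 'a) \<Rightarrow> bool" where
  "good n W x \<longleftrightarrow> (\<forall>\<phi>. outer x \<phi> \<in> W \<longrightarrow> dot n \<phi> x = 0 \<longrightarrow> (\<forall>j<n. \<phi> j = 0))"

definition functional :: "((nat \<Rightarrow> nat \<Rightarrow> 'a::field) \<Rightarrow> 'a) \<Rightarrow> bool" where
  "functional l \<longleftrightarrow> (\<forall>s A t B. l (lin2 s A t B) = s * l A + t * l B)"

text \<open>Dimension is bounded from above by exhibiting linear forms without a common zero. As the forms are
defined on all matrices, bounds for images and kernels combine by taking unions of sets of forms, and
no bases are needed.\<close>
definition dim_le :: "nat \<Rightarrow> (nat \<Rightarrow> nat \<Rightarrow> 'a::field) set \<Rightarrow> nat \<Rightarrow> bool" where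
  "dim_le n W d \<longleftrightarrow> (\<exists>L. finite L \<and> card L \<le> d \<and> (\<forall>l\<in>L. functional l) \<and>
     (\<forall>A\<in>W. (\<forall>l\<in>L. l A = 0) \<longrightarrow> (\<forall>i<n. \<forall>j<n. A i j = 0)))"

lemma mspace_lin2: "mspace n W \<Longrightarrow> A \<in> W \<Longrightarrow> B \<in> W \<Longrightarrow> lin2 s A t B \<in> W"
  by (simp add: mspace_def)

lemma mspace_cong:
  "mspace n W \<Longrightarrow> A \<in> W \<Longrightarrow> (\<And>i j. i < n \<Longrightarrow> j < n \<Longrightarrow> B i j = A i j) \<Longrightarrow> B \<in> W"
  by (simp add: mspace_def)

lemma mspace_combine:
  assumes "mspace n W" "A \<in> W" "B \<in> W"
    "\<And>i j. i < n \<Longrightarrow> j < n \<Longrightarrow> C i j = s * A i j + t * B i j"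
  shows "C \<in> W"
  by (rule mspace_cong[OF assms(1) mspace_lin2[OF assms(1-3), of s t]])
    (simp add: lin2_def assms(4))

lemma mv_lin2: "mv n (lin2 s A t B) v i = s * mv n A v i + t * mv n B v i"
  by (simp add: mv_def lin2_def sum.distrib sum_distrib_left algebra_simps)

lemma mv_outer: "mv n (outer x \<phi>) v i = dot n \<phi> v * x i"
  by (simp add: mv_def outer_def dot_def sum_distrib_left sum_distrib_right mult_ac)

lemma mv_comb: "mv n A (\<lambda>j. s * v j + t * w j) i = s * mv n A v i + t * mv n A w i"
  by (simp add: mv_def sum.distrib sum_distrib_left algebra_simps)

lemma dot_comb_left: "dot n (\<lambda>j. s * v j + t * w j) x = s * dot n v x + t * dot n w x"
  by (simp add: dot_def sum.distrib sum_distrib_left algebra_simps)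

lemma quad_freeD:
  assumes "quad_free n A" "\<And>e. e^2 \<noteq> d" "\<And>i. i < n \<Longrightarrow> mv n A h i = \<mu> * h i + k i"
    "\<And>i. i < n \<Longrightarrow> mv n A k i = \<mu> * k i + d * h i" "i < n"
  shows "h i = 0"
  using assms(1)[unfolded quad_free_def, rule_format, of d h \<mu> k i] assms(2-5) by simp

text \<open>On the span of \<open>x\<close> and \<open>y\<close> the matrix \<open>s (x \<otimes> \<phi>) + t (y \<otimes> \<psi>)\<close> acts as a \<open>2 \<times> 2\<close>
matrix. After subtracting half its trace, its square is the scalar \<open>\<delta>\<^sup>2 + s t c\<close> with
\<open>c = \<phi>(y) \<psi>(x)\<close> and \<open>2 \<delta> = s \<phi>(x) - t \<psi>(y)\<close>, so this scalar must be a square for all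
\<open>s\<close> and \<open>t\<close>.\<close>
lemma rank_one_pair:
  fixes W :: "(nat \<Rightarrow> nat \<Rightarrow> 'a::field) set"
  assumes np: "\<not> pythagorean TYPE('a)" and W: "qf_space n W"
    and x: "outer x \<phi> \<in> W" and y: "outer y \<psi> \<in> W"
  shows "dot n \<phi> y * dot n \<psi> x = 0 \<or> dot n \<phi> y * dot n \<psi> x = dot n \<phi> x * dot n \<psi> y"
proof (rule ccontr)
  assume neg: "\<not> ?thesis"
  define p q c where "p = dot n \<phi> x" "q = dot n \<psi> y" "c = dot n \<phi> y * dot n \<psi> x"
  have two: "(2::'a) \<noteq> 0" by (rule non_pythagorean_two_neq_0[OF np])
  obtain s t where st: "\<And>e. e^2 \<noteq> ((s * p - t * q) / 2)^2 + s * t * c"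
    using binary_form_nonsquare_value[OF np, of c p q] neg by (auto simp: p_q_c_def)
  define A where "A = lin2 s (outer x \<phi>) t (outer y \<psi>)"
  define \<delta> where "\<delta> = (s * p - t * q) / 2"
  define \<mu> where "\<mu> = (s * p + t * q) / 2"
  define k where "k = (\<lambda>i. \<delta> * x i + (t * dot n \<psi> x) * y i)"
  have half: "a / 2 + a / 2 = a" for a :: 'a
    using two by (simp add: field_simps)
  have sp: "s * p = \<mu> + \<delta>" and tq: "t * q = \<mu> - \<delta>"
    using half[of "s * p"] half[of "t * q"]
    by (simp_all add: \<mu>_def \<delta>_def add_divide_distrib diff_divide_distrib algebra_simps)
  have Ax: "mv n A x i = \<mu> * x i + k i" for i
  proof -
    have "mv n A x i = (s * p) * x i + t * dot n \<psi> x * y i"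
      by (simp add: A_def mv_lin2 mv_outer p_q_c_def(1))
    then show ?thesis by (simp add: sp k_def distrib_right)
  qed
  have Ay: "mv n A y i = (s * dot n \<phi> y) * x i + (t * q) * y i" for i
    by (simp add: A_def mv_lin2 mv_outer p_q_c_def(2))
  have Ak: "mv n A k i = \<mu> * k i + (\<delta>^2 + s * t * c) * x i" for i
    unfolding k_def mv_comb Ax Ay tq
    by (simp add: k_def p_q_c_def(3) algebra_simps power2_eq_square)
  have "quad_free n A"
    using W mspace_lin2[of n W, OF _ x y] by (simp add: qf_space_def A_def)
  then have "x i = 0" if "i < n" for i
    using quad_freeD[of n A "\<delta>^2 + s * t * c" x \<mu> k i] Ax Ak that st by (simp add: \<delta>_def)
  then have "dot n \<psi> x = 0" by (simp add: dot_def)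
  with neg show False by simp
qed

section \<open>Good vectors on the moment curve\<close>

text \<open>The exponents decrease so that the last coordinate is \<open>1\<close> everywhere on the curve; quotients below
are formed by eliminating the last coordinate.\<close>
definition moment :: "nat \<Rightarrow> 'a::field \<Rightarrow> nat \<Rightarrow> 'a" where
  "moment n t i = t ^ (n - Suc i)"

text \<open>On the curve a linear form becomes a nonzero polynomial of degree less than \<open>n\<close>.\<close>
lemma moment_roots:
  fixes \<phi> :: "nat \<Rightarrow> 'a::field"
  assumes "\<exists>j<n. \<phi> j \<noteq> 0"
  shows "finite {t. dot n \<phi> (moment n t) = 0}" "card {t. dot n \<phi> (moment n t) = 0} \<le> n - 1"
proof -
  obtain j where j: "j < n" "\<phi> j \<noteq> 0" using assms by blast
  define P where "P = (\<Sum>i<n. monom (\<phi> i) (n - Suc i))"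
  have "coeff P (n - Suc j) = (\<Sum>i<n. if i = j then \<phi> i else 0)"
    unfolding P_def coeff_sum using j(1) by (intro sum.cong) auto
  then have "P \<noteq> 0" using j by auto
  have poly: "poly P t = dot n \<phi> (moment n t)" for t
    by (simp add: P_def poly_sum poly_monom dot_def moment_def)
  have "degree P \<le> n - 1"
    unfolding P_def by (intro degree_sum_le) (auto intro: order_trans[OF degree_monom_le])
  then show "finite {t. dot n \<phi> (moment n t) = 0}"
    "card {t. dot n \<phi> (moment n t) = 0} \<le> n - 1"
    using poly_roots_finite[OF \<open>P \<noteq> 0\<close>] card_poly_roots_bound[OF \<open>P \<noteq> 0\<close>]
    by (auto simp: poly)
qed

text \<open>Let \<open>S\<close> be a finite set of bad parameters, \<open>\<phi>\<^sub>t\<close> witnessing that \<open>t\<close> is bad, and let \<open>R\<close> be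
the set of pairs \<open>(t, u)\<close> such that \<open>\<phi>\<^sub>t\<close> vanishes at the point of \<open>u\<close>. By \<open>rank_one_pair\<close>, one of \<open>(t, u)\<close> and
\<open>(u, t)\<close> lies in \<open>R\<close>, hence \<open>\<bar>S\<bar>\<^sup>2 \<le> 2 \<bar>R\<bar> \<le> 2 \<bar>S\<bar> (n - 1)\<close>.\<close>
lemma finite_bad_moment:
  fixes W :: "(nat \<Rightarrow> nat \<Rightarrow> 'a::field) set"
  assumes np: "\<not> pythagorean TYPE('a)" and W: "qf_space n W"
  shows "finite {t. \<not> good n W (moment n t)}"
proof (rule ccontr)
  assume "infinite {t. \<not> good n W (moment n t)}"
  \<comment> \<open>Any size above \<open>2 (n - 1)\<close> leads to a contradiction.\<close>
  then obtain S where S: "S \<subseteq> {t. \<not> good n W (moment n t)}" "finite S" "card S = 2 * n + 1"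
    using infinite_arbitrarily_large[of "{t. \<not> good n W (moment n t)}" "2 * n + 1"] by auto
  have "\<exists>\<phi>. outer (moment n t) \<phi> \<in> W \<and> dot n \<phi> (moment n t) = 0 \<and> (\<exists>j<n. \<phi> j \<noteq> 0)"
    if "t \<in> S" for t
    using S(1) that unfolding good_def by auto
  then obtain \<phi> where "\<forall>t\<in>S. outer (moment n t) (\<phi> t) \<in> W \<and>
      dot n (\<phi> t) (moment n t) = 0 \<and> (\<exists>j<n. \<phi> t j \<noteq> 0)"
    using bchoice[of S "\<lambda>t \<phi>. outer (moment n t) \<phi> \<in> W \<and> dot n \<phi> (moment n t) = 0 \<and> (\<exists>j<n. \<phi> j \<noteq> 0)"]
    by auto
  then have \<phi>: "\<And>t. t \<in> S \<Longrightarrow> outer (moment n t) (\<phi> t) \<in> W"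
    "\<And>t. t \<in> S \<Longrightarrow> dot n (\<phi> t) (moment n t) = 0" "\<And>t. t \<in> S \<Longrightarrow> \<exists>j<n. \<phi> t j \<noteq> 0"
    by auto
  define R where "R = (SIGMA t:S. {u\<in>S. dot n (\<phi> t) (moment n u) = 0})"
  have sub: "S \<times> S \<subseteq> R \<union> prod.swap ` R"
  proof
    fix p assume "p \<in> S \<times> S"
    then obtain t u where p: "p = (t, u)" "t \<in> S" "u \<in> S" by blast
    have "dot n (\<phi> t) (moment n u) = 0 \<or> dot n (\<phi> u) (moment n t) = 0"
      using rank_one_pair[OF np W \<phi>(1)[OF p(2)] \<phi>(1)[OF p(3)]] \<phi>(2)[OF p(2)] by simp
    then have "(t, u) \<in> R \<or> (u, t) \<in> R" using p by (simp add: R_def)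
    then show "p \<in> R \<union> prod.swap ` R" 
      using image_eqI[of "(t, u)" prod.swap "(u, t)" R] by (auto simp: p(1))
  qed
  have finR: "finite R" using S(2) by (simp add: R_def)
  have "card {u\<in>S. dot n (\<phi> t) (moment n u) = 0} \<le> n - 1" if "t \<in> S" for t
  proof -
    have "card {u\<in>S. dot n (\<phi> t) (moment n u) = 0} \<le> card {u. dot n (\<phi> t) (moment n u) = 0}"
      by (rule card_mono[OF moment_roots(1)[OF \<phi>(3)[OF that]]]) auto
    also have "\<dots> \<le> n - 1" by (rule moment_roots(2)[OF \<phi>(3)[OF that]])
    finally show ?thesis .
  qed
  then have "card R \<le> card S * (n - 1)"
    unfolding R_def using S(2)
      sum_bounded_above[of S "\<lambda>t. card {u\<in>S. dot n (\<phi> t) (moment n u) = 0}" "n - 1"] by simp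
  moreover have "card S * card S \<le> card R + card R"
  proof -
    have "card S * card S \<le> card (R \<union> prod.swap ` R)"
      using card_mono[OF _ sub] finR S(2) by (simp add: card_cartesian_product)
    also have "\<dots> \<le> card R + card (prod.swap ` R)" by (rule card_Un_le)
    also have "\<dots> \<le> card R + card R" using card_image_le[OF finR] by simp
    finally show ?thesis .
  qed
  ultimately have "card S * card S \<le> card S * (2 * (n - 1))"
    by (simp only: mult_2 distrib_left)
  moreover have "0 < card S" using S(3) by simp
  ultimately have "card S \<le> 2 * (n - 1)" by simp
  with S(3) show False by simp
qed

section \<open>Quotients by a vector and the dimension bound\<close>

definition tri :: "nat \<Rightarrow> nat" where
  "tri n = n * (n + 1) div 2"

lemma tri_0 [simp]: "tri 0 = 0" by (simp add: tri_def)

lemma tri_Suc [simp]: "tri (Suc n) = tri n + n + 1" by (simp add: tri_def)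

lemma mv_Suc: "mv (Suc n) A v i = mv n A v i + A i n * v n"
  by (simp add: mv_def)

lemma dot_Suc: "dot (Suc n) \<phi> v = dot n \<phi> v + \<phi> n * v n"
  by (simp add: dot_def)

definition extend :: "nat \<Rightarrow> (nat \<Rightarrow> 'a::field) \<Rightarrow> nat \<Rightarrow> 'a" where
  "extend n v i = (if i < n then v i else 0)"

lemma extend_lt: "i < n \<Longrightarrow> extend n v i = v i"
  by (simp add: extend_def)

lemma extend_n: "extend n v n = 0"
  by (simp add: extend_def)

lemma mv_Suc_extend: "mv (Suc n) A (extend n v) i = mv n A v i"
  by (simp add: mv_def extend_def)

lemma mv_cong: "(\<And>j. j < n \<Longrightarrow> A i j = B i' j) \<Longrightarrow> (\<And>j. j < n \<Longrightarrow> v j = w j) \<Longrightarrow> mv n A v i = mv n B w i'"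
  by (simp add: mv_def)

lemma dot_cong: "(\<And>j. j < n \<Longrightarrow> \<phi> j = \<psi> j) \<Longrightarrow> (\<And>j. j < n \<Longrightarrow> v j = w j) \<Longrightarrow> dot n \<phi> v = dot n \<psi> w"
  by (simp add: dot_def)

text \<open>The matrices of \<open>W\<close> with eigenvector \<open>y\<close>, acting on the quotient by \<open>y\<close>. With \<open>y n = 1\<close>,
the first \<open>n\<close> coordinates of \<open>v - v\<^sub>n y\<close> are coordinates of the class of \<open>v\<close>.\<close>
definition quot :: "nat \<Rightarrow> (nat \<Rightarrow> nat \<Rightarrow> 'a::field) set \<Rightarrow> (nat \<Rightarrow> 'a) \<Rightarrow> (nat \<Rightarrow> nat \<Rightarrow> 'a) set" where
  "quot n W y = {B. \<exists>A\<in>W. (\<forall>i<n. mv (Suc n) A y i = mv (Suc n) A y n * y i) \<and>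
     (\<forall>i<n. \<forall>j<n. B i j = A i j - y i * A n j)}"

text \<open>A forbidden pair \<open>(h, k)\<close> for the quotient satisfies the equations for \<open>A\<close> up to multiples \<open>\<rho> y\<close>
and \<open>\<kappa> y\<close>. These are absorbed by replacing the pair with \<open>(h + \<beta> y, k + \<gamma> y)\<close>. The linear
system for \<open>\<beta>\<close> and \<open>\<gamma>\<close> has determinant \<open>d - (\<alpha> - \<mu>)\<^sup>2\<close>, where \<open>\<alpha>\<close> is the eigenvalue
of \<open>y\<close>, and this is nonzero because \<open>d\<close> is not a square.\<close>
lemma quad_free_quot:
  fixes y :: "nat \<Rightarrow> 'a::field"
  assumes A: "quad_free (Suc n) A" and y: "y n = 1"
    and eig: "\<And>i. i < n \<Longrightarrow> mv (Suc n) A y i = mv (Suc n) A y n * y i"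
    and B: "\<And>i j. i < n \<Longrightarrow> j < n \<Longrightarrow> B i j = A i j - y i * A n j"
  shows "quad_free n B"
  unfolding quad_free_def
proof (intro allI impI)
  fix \<mu> d h k i0
  assume d: "\<forall>e. e^2 \<noteq> d" and h: "\<forall>i<n. mv n B h i = \<mu> * h i + k i"
    and k: "\<forall>i<n. mv n B k i = \<mu> * k i + d * h i" and i0: "i0 < n"
  define \<alpha> where "\<alpha> = mv (Suc n) A y n"
  have Ay: "mv (Suc n) A y i = \<alpha> * y i" if "i < Suc n" for i
    using that eig y by (auto simp: \<alpha>_def less_Suc_eq)
  have Bv: "mv n B v i = mv n A v i - y i * mv n A v n" if "i < n" for v i
    using that by (simp add: mv_def B left_diff_distrib sum_subtractf sum_distrib_left mult.assoc)
  have Ah: "mv (Suc n) A (extend n h) i = \<mu> * extend n h i + extend n k i + mv n A h n * y i" if "i < Suc n" for i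
    using that h Bv[of i h] y by (auto simp: mv_Suc_extend extend_lt extend_n less_Suc_eq algebra_simps)
  have Ak: "mv (Suc n) A (extend n k) i = \<mu> * extend n k i + d * extend n h i + mv n A k n * y i" if "i < Suc n" for i
    using that k Bv[of i k] y by (auto simp: mv_Suc_extend extend_lt extend_n less_Suc_eq algebra_simps)
  define \<rho> \<kappa> where "\<rho> = mv n A h n" "\<kappa> = mv n A k n"
  define \<beta> where "\<beta> = (\<kappa> + \<rho> * (\<alpha> - \<mu>)) / (d - (\<alpha> - \<mu>)^2)"
  define \<gamma> where "\<gamma> = \<rho> + \<beta> * (\<alpha> - \<mu>)"
  have "d - (\<alpha> - \<mu>)^2 \<noteq> 0" using d by (metis eq_iff_diff_eq_0)
  then have \<beta>: "\<kappa> + \<rho> * (\<alpha> - \<mu>) = \<beta> * (d - (\<alpha> - \<mu>)^2)" by (simp add: \<beta>_def)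
  then have \<gamma>: "\<kappa> + \<gamma> * \<alpha> = \<mu> * \<gamma> + d * \<beta>"
    by (simp add: \<gamma>_def algebra_simps power2_eq_square)
  define h' k' where "h' = (\<lambda>i. 1 * extend n h i + \<beta> * y i)" "k' = (\<lambda>i. 1 * extend n k i + \<gamma> * y i)"
  have "mv (Suc n) A h' i = \<mu> * h' i + k' i" if "i < Suc n" for i
    unfolding h'_k'_def mv_comb using that
    by (simp add: Ah Ay \<rho>_\<kappa>_def[symmetric] \<gamma>_def algebra_simps)
  moreover have "mv (Suc n) A k' i = \<mu> * k' i + d * h' i" if "i < Suc n" for i
  proof -
    have "mv (Suc n) A k' i = \<mu> * extend n k i + d * extend n h i + (\<kappa> + \<gamma> * \<alpha>) * y i"
      unfolding h'_k'_def mv_comb using that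
      by (simp add: Ak Ay \<rho>_\<kappa>_def[symmetric] algebra_simps)
    then show ?thesis unfolding \<gamma> by (simp add: h'_k'_def algebra_simps)
  qed
  ultimately have z: "h' i = 0" if "i < Suc n" for i
    using quad_freeD[OF A, of d h' \<mu> k' i] d that by blast
  have "\<beta> = 0" using z[of n] y by (simp add: h'_k'_def extend_n)
  then show "h i0 = 0" using z[of i0] i0 by (simp add: h'_k'_def extend_lt)
qed

lemma qf_space_quot:
  assumes W: "qf_space (Suc n) W" and y: "y n = 1"
  shows "qf_space n (quot n W y)"
  unfolding qf_space_def mspace_def
proof (intro conjI ballI allI impI)
  fix A B s t assume "A \<in> quot n W y" "B \<in> quot n W y"
  then obtain A' B' where AB: "A' \<in> W" "B' \<in> W"
    "\<And>i. i < n \<Longrightarrow> mv (Suc n) A' y i = mv (Suc n) A' y n * y i"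
    "\<And>i. i < n \<Longrightarrow> mv (Suc n) B' y i = mv (Suc n) B' y n * y i"
    "\<And>i j. i < n \<Longrightarrow> j < n \<Longrightarrow> A i j = A' i j - y i * A' n j"
    "\<And>i j. i < n \<Longrightarrow> j < n \<Longrightarrow> B i j = B' i j - y i * B' n j"
    unfolding quot_def by auto
  have "lin2 s A' t B' \<in> W"
    using W mspace_lin2[of "Suc n" W A' B' s t] AB(1,2) by (simp add: qf_space_def)
  moreover have "mv (Suc n) (lin2 s A' t B') y i = mv (Suc n) (lin2 s A' t B') y n * y i"
    if "i < n" for i
    unfolding mv_lin2 AB(3)[OF that] AB(4)[OF that] by (simp add: algebra_simps)
  moreover have "lin2 s A t B i j = lin2 s A' t B' i j - y i * lin2 s A' t B' n j"
    if "i < n" "j < n" for i j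
    unfolding lin2_def AB(5)[OF that] AB(6)[OF that] by (simp add: algebra_simps)
  ultimately show "lin2 s A t B \<in> quot n W y" unfolding quot_def by blast
next
  fix A B assume "A \<in> quot n W y" "\<forall>i<n. \<forall>j<n. B i j = A i j"
  then show "B \<in> quot n W y" unfolding quot_def by auto
next
  fix B assume "B \<in> quot n W y"
  then show "quad_free n B" using W quad_free_quot[where n = n and y = y, OF _ y]
    unfolding quot_def qf_space_def by blast
qed

lemma functional_mv: "functional (\<lambda>A. mv n A v i)"
  by (simp add: functional_def mv_lin2)

lemma dim_leE:
  assumes "dim_le n W d"
  obtains L where "finite L" "card L \<le> d" "\<And>l. l \<in> L \<Longrightarrow> functional l"
    "\<And>A i j. A \<in> W \<Longrightarrow> (\<And>l. l \<in> L \<Longrightarrow> l A = 0) \<Longrightarrow> i < n \<Longrightarrow> j < n \<Longrightarrow> A i j = 0"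
proof -
  from assms obtain L where "finite L \<and> card L \<le> d \<and> (\<forall>l\<in>L. functional l) \<and>
     (\<forall>A\<in>W. (\<forall>l\<in>L. l A = 0) \<longrightarrow> (\<forall>i<n. \<forall>j<n. A i j = 0))"
    unfolding dim_le_def ..
  then show thesis by (intro that[of L]) simp_all
qed

lemma dim_leI:
  assumes "finite L" "card L \<le> d" "\<And>l. l \<in> L \<Longrightarrow> functional l"
    "\<And>A i j. A \<in> W \<Longrightarrow> (\<And>l. l \<in> L \<Longrightarrow> l A = 0) \<Longrightarrow> i < n \<Longrightarrow> j < n \<Longrightarrow> A i j = 0"
  shows "dim_le n W d"
  unfolding dim_le_def by (rule exI[of _ L]) (simp add: assms)

text \<open>Rank and nullity for the action on the line of \<open>y\<close>: \<open>n\<close> forms test whether \<open>y\<close> is an eigenvector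
of \<open>A\<close>, \<open>d\<close> forms test whether \<open>A\<close> is zero on the quotient, and if all of them vanish then \<open>A\<close>
has the form \<open>outer y \<phi>\<close>, which is left to the forms in \<open>E\<close>.\<close>
lemma dim_le_quot:
  fixes W :: "(nat \<Rightarrow> nat \<Rightarrow> 'a::field) set"
  assumes W: "mspace (Suc n) W" and y: "y n = 1"
    and d: "dim_le n (quot n W y) d"
    and E: "finite E" "card E \<le> e" "\<And>l. l \<in> E \<Longrightarrow> functional l"
    and inj: "\<And>\<phi> j. outer y \<phi> \<in> W \<Longrightarrow> (\<And>l. l \<in> E \<Longrightarrow> l (outer y \<phi>) = 0) \<Longrightarrow> j < Suc n \<Longrightarrow> \<phi> j = 0"
    and E_cong: "\<And>l A B. l \<in> E \<Longrightarrow> (\<And>i j. i < Suc n \<Longrightarrow> j < Suc n \<Longrightarrow> A i j = B i j) \<Longrightarrow> l A = l B"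
  shows "dim_le (Suc n) W (n + d + e)"
proof -
  from d obtain L where L: "finite L" "card L \<le> d" "\<And>l. l \<in> L \<Longrightarrow> functional l"
    "\<And>A i j. A \<in> quot n W y \<Longrightarrow> (\<And>l. l \<in> L \<Longrightarrow> l A = 0) \<Longrightarrow> i < n \<Longrightarrow> j < n \<Longrightarrow> A i j = 0"
    by (rule dim_leE) metis
  define q :: "(nat \<Rightarrow> nat \<Rightarrow> 'a) \<Rightarrow> nat \<Rightarrow> nat \<Rightarrow> 'a"
    where "q = (\<lambda>A i j. A i j - y i * A n j)"
  define l1 where "l1 = (\<lambda>i A. mv (Suc n) A y i - mv (Suc n) A y n * y i)"
  define l2 where "l2 = (\<lambda>l A. l (q A) :: 'a)"
  have q: "q (lin2 s A t B) = lin2 s (q A) t (q B)" for s A t B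
    by (intro ext) (simp add: q_def lin2_def algebra_simps)
  let ?L = "l1 ` {..<n} \<union> l2 ` L \<union> E"
  have "finite ?L" using L(1) E(1) by simp
  moreover have "card ?L \<le> n + d + e"
  proof -
    have "card (l1 ` {..<n}) \<le> n" using card_image_le[of "{..<n}" l1] by simp
    moreover have "card (l2 ` L) \<le> d" using card_image_le[OF L(1), of l2] L(2) by simp
    ultimately show ?thesis
      using card_Un_le[of "l1 ` {..<n}" "l2 ` L"] card_Un_le[of "l1 ` {..<n} \<union> l2 ` L" E] E(2)
      by linarith
  qed
  moreover have "functional l" if "l \<in> ?L" for l
    using that L(3) E(3)
    by (auto simp: functional_def l1_def l2_def q mv_lin2 algebra_simps)
  moreover have "A i j = 0"
    if A: "A \<in> W" "\<And>l. l \<in> ?L \<Longrightarrow> l A = 0" and ij: "i < Suc n" "j < Suc n" for A i j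
  proof -
    have eig: "mv (Suc n) A y i = mv (Suc n) A y n * y i" if "i < n" for i
      using A(2)[of "l1 i"] that by (simp add: l1_def)
    have "q A \<in> quot n W y" using A(1) eig by (auto simp: quot_def q_def)
    then have "q A i j = 0" if "i < n" "j < n" for i j
    proof -
      have "l (q A) = 0" if "l \<in> L" for l using A(2)[of "l2 l"] that by (simp add: l2_def)
      with \<open>q A \<in> quot n W y\<close> show ?thesis using L(4) that by blast
    qed
    then have blk: "A i j = y i * A n j" if "i < n" "j < n" for i j
      using that by (simp add: q_def)
    have col: "A i n = y i * A n n" if "i < n" for i
    proof -
      have "mv n A y i = y i * mv n A y n"
        using that by (simp add: mv_def blk sum_distrib_left mult_ac)
      then show ?thesis using eig[OF that] y by (simp add: mv_Suc algebra_simps)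
    qed
    have out: "A i j = outer y (A n) i j" if "i < Suc n" "j < Suc n" for i j
      using that blk col y by (auto simp: outer_def less_Suc_eq)
    then have "outer y (A n) \<in> W" using mspace_cong[OF W A(1), of "outer y (A n)"] by simp
    moreover have "l (outer y (A n)) = 0" if "l \<in> E" for l
      using E_cong[OF that, of A "outer y (A n)"] out A(2)[of l] that by simp
    ultimately have "A n j = 0" by (rule inj[OF _ _ ij(2)])
    then show ?thesis using out[OF ij] by (simp add: outer_def)
  qed
  ultimately show ?thesis by (rule dim_leI)
qed

text \<open>For a good \<open>y\<close> a matrix \<open>outer y \<phi>\<close> in \<open>W\<close> is determined by its eigenvalue \<open>\<phi>(y)\<close>.\<close>
lemma dim_le_good:
  fixes W :: "(nat \<Rightarrow> nat \<Rightarrow> 'a::field) set"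
  assumes W: "mspace (Suc n) W" and y: "y n = 1" and d: "dim_le n (quot n W y) d"
    and good: "good (Suc n) W y"
  shows "dim_le (Suc n) W (n + d + 1)"
proof (rule dim_le_quot[OF W y d, where E = "{\<lambda>A. mv (Suc n) A y n}"])
  fix \<phi> j assume "outer y \<phi> \<in> W" "\<And>l. l \<in> {\<lambda>A. mv (Suc n) A y n} \<Longrightarrow> l (outer y \<phi>) = 0" "j < Suc n"
  then show "\<phi> j = 0" using good y by (auto simp: good_def mv_outer)
next
  fix l and A B :: "nat \<Rightarrow> nat \<Rightarrow> 'a"
  assume "l \<in> {\<lambda>A. mv (Suc n) A y n}" "\<And>i j. i < Suc n \<Longrightarrow> j < Suc n \<Longrightarrow> A i j = B i j"
  then show "l A = l B" by (auto intro: mv_cong)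
qed (auto simp: functional_mv)

lemma exists_good_moment:
  fixes W :: "(nat \<Rightarrow> nat \<Rightarrow> 'a::field) set"
  assumes "infinite (UNIV :: 'a set)" "\<not> pythagorean TYPE('a)" "qf_space n W"
  obtains t where "good n W (moment n t)"
proof -
  have "{t. \<not> good n W (moment n t)} \<noteq> UNIV"
    using finite_bad_moment[OF assms(2,3)] assms(1) by metis
  then show thesis using that by blast
qed

theorem qf_space_dim_le:
  fixes W :: "(nat \<Rightarrow> nat \<Rightarrow> 'a::field) set"
  assumes inf: "infinite (UNIV :: 'a set)" and np: "\<not> pythagorean TYPE('a)"
  shows "qf_space n W \<Longrightarrow> dim_le n W (tri n)"
proof (induction n arbitrary: W)
  case 0
  show ?case unfolding dim_le_def by (rule exI[of _ "{}"]) simp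
next
  case (Suc n)
  obtain t where t: "good (Suc n) W (moment (Suc n) t)"
    by (rule exists_good_moment[OF inf np Suc.prems])
  have y: "moment (Suc n) t n = 1" by (simp add: moment_def)
  have "qf_space n (quot n W (moment (Suc n) t))"
    using qf_space_quot[where W = W and y = "moment (Suc n) t"] Suc.prems y by blast
  then have "dim_le n (quot n W (moment (Suc n) t)) (tri n)" by (rule Suc.IH)
  then have "dim_le (Suc n) W (n + tri n + 1)"
    using dim_le_good[where W = W and y = "moment (Suc n) t"] y t Suc.prems
    by (simp add: qf_space_def)
  then show ?case by (simp add: add.commute add.left_commute)
qed

text \<open>The bound of \<open>qf_space_dim_le\<close> is attained.\<close>
definition maximal_qf :: "nat \<Rightarrow> (nat \<Rightarrow> nat \<Rightarrow> 'a::field) set \<Rightarrow> bool" where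
  "maximal_qf n W \<longleftrightarrow> qf_space n W \<and> (\<forall>d. dim_le n W d \<longrightarrow> tri n \<le> d)"

text \<open>Otherwise \<open>dim_le_quot\<close> with an empty set of additional forms would save one dimension.\<close>
lemma maximal_rank_one:
  fixes W :: "(nat \<Rightarrow> nat \<Rightarrow> 'a::field) set"
  assumes inf: "infinite (UNIV :: 'a set)" and np: "\<not> pythagorean TYPE('a)"
    and W: "maximal_qf (Suc n) W" and y: "y n = 1"
  obtains \<phi> j where "outer y \<phi> \<in> W" "j < Suc n" "\<phi> j \<noteq> 0"
proof (rule ccontr)
  assume "\<not> thesis"
  with that have "\<And>\<phi> j. outer y \<phi> \<in> W \<Longrightarrow> j < Suc n \<Longrightarrow> \<phi> j = 0" by blast
  moreover have qf: "qf_space (Suc n) W" using W by (simp add: maximal_qf_def)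
  ultimately have inj: "\<And>\<phi> j. outer y \<phi> \<in> W \<Longrightarrow> j < Suc n \<Longrightarrow> \<phi> j = 0" and qf: "qf_space (Suc n) W"
    by auto
  have "qf_space n (quot n W y)" using qf_space_quot[where W = W and y = y] qf y by blast
  then have "dim_le n (quot n W y) (tri n)" by (rule qf_space_dim_le[OF inf np])
  then have "dim_le (Suc n) W (n + tri n + 0)"
    using qf y inj by (intro dim_le_quot[where E = "{}" and y = y]) (auto simp: qf_space_def)
  then have "tri (Suc n) \<le> n + tri n" using W unfolding maximal_qf_def by (metis add_0_right)
  then show False by simp
qed

section \<open>Rank-one matrices in a maximal space\<close>

text \<open>Infinitely many points of the moment curve span the whole space. In the induction step, the weights
\<open>a t / (t - t0)\<close> turn a solution for \<open>Y (i + 1) - t0 Y i\<close> into a solution for \<open>Y\<close> up to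
a multiple of the powers of \<open>t0\<close>, which the weight at \<open>t0\<close> corrects.\<close>
lemma moment_span:
  fixes Y :: "nat \<Rightarrow> 'a::field"
  assumes "infinite S"
  shows "\<exists>T b. finite T \<and> T \<subseteq> S \<and> (\<forall>i<n. (\<Sum>t\<in>T. b t * t ^ i) = Y i)"
  using assms
proof (induction n arbitrary: S Y)
  case 0
  show ?case by (rule exI[of _ "{}"]) simp
next
  case (Suc n)
  from Suc.prems obtain t0 where t0: "t0 \<in> S" using infinite_imp_nonempty by blast
  have "infinite (S - {t0})" using Suc.prems by simp
  from Suc.IH[OF this, of "\<lambda>i. Y (Suc i) - t0 * Y i"]
  obtain T a where T: "finite T" "T \<subseteq> S - {t0}"
    and a: "\<And>i. i < n \<Longrightarrow> (\<Sum>t\<in>T. a t * t ^ i) = Y (Suc i) - t0 * Y i" by auto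
  define b where "b = (\<lambda>t. a t / (t - t0))"
  define b' where "b' = b(t0 := Y 0 - (\<Sum>t\<in>T. b t))"
  have "t0 \<notin> T" using T by blast
  then have sum: "(\<Sum>t\<in>insert t0 T. b' t * t ^ i) = b' t0 * t0 ^ i + (\<Sum>t\<in>T. b t * t ^ i)" for i
    using T(1) by (auto simp: b'_def intro!: sum.cong)
  have step: "(\<Sum>t\<in>T. b t * t ^ Suc i) = t0 * (\<Sum>t\<in>T. b t * t ^ i) + (\<Sum>t\<in>T. a t * t ^ i)" for i
    unfolding sum_distrib_left sum.distrib[symmetric]
  proof (rule sum.cong[OF refl])
    fix t assume "t \<in> T"
    then have "a t = b t * (t - t0)" using \<open>t0 \<notin> T\<close> by (auto simp: b_def)
    show "b t * t ^ Suc i = t0 * (b t * t ^ i) + a t * t ^ i"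
      unfolding \<open>a t = b t * (t - t0)\<close> by (simp add: algebra_simps)
  qed
  have "(\<Sum>t\<in>insert t0 T. b' t * t ^ i) = Y i" if "i < Suc n" for i
    using that
  proof (induction i)
    case 0
    show ?case unfolding sum by (simp add: b'_def)
  next
    case (Suc i)
    have "(\<Sum>t\<in>insert t0 T. b' t * t ^ Suc i)
        = t0 * (\<Sum>t\<in>insert t0 T. b' t * t ^ i) + (\<Sum>t\<in>T. a t * t ^ i)"
      by (simp only: sum step) (simp add: algebra_simps)
    then show ?case using Suc a[of i] by simp
  qed
  then show ?case using T t0 by (intro exI[of _ "insert t0 T"] exI[of _ b']) auto
qed

lemma mspace_outer_sum:
  assumes W: "mspace n W" and ne: "W \<noteq> {}" and "finite T" "\<And>t. t \<in> T \<Longrightarrow> outer (v t) \<phi> \<in> W"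
  shows "outer (\<lambda>i. \<Sum>t\<in>T. b t * v t i) \<phi> \<in> W"
  using assms(3,4)
proof (induction T rule: finite_induct)
  case empty
  obtain A where "A \<in> W" using ne by blast
  from mspace_combine[OF W this this, of _ 0 0] show ?case by (simp add: outer_def)
next
  case (insert t T)
  then have "outer (v t) \<phi> \<in> W" "outer (\<lambda>i. \<Sum>t\<in>T. b t * v t i) \<phi> \<in> W" by auto
  from mspace_combine[OF W this, of _ "b t" 1] insert.hyps show ?case
    by (simp add: outer_def distrib_right)
qed

definition unit :: "nat \<Rightarrow> nat \<Rightarrow> 'a::field" where
  "unit k i = (if i = k then 1 else 0)"

lemma mv_unit: "k < n \<Longrightarrow> mv n A (unit k) i = A i k"
  by (simp add: mv_def unit_def if_distrib cong: if_cong)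

lemma dot_unit: "k < n \<Longrightarrow> dot n \<phi> (unit k) = \<phi> k"
  by (simp add: dot_def unit_def if_distrib cong: if_cong)

lemma dot_unit_left: "k < n \<Longrightarrow> dot n (unit k) v = v k"
  using dot_unit[of k n v] by (simp add: dot_def mult.commute)

lemma quot_unitI:
  assumes "A \<in> W" "\<And>i. i < n \<Longrightarrow> A i n = 0" "\<And>i j. i < n \<Longrightarrow> j < n \<Longrightarrow> B i j = A i j"
  shows "B \<in> quot n W (unit n)"
  unfolding quot_def using assms
  by (intro CollectI bexI[of _ A]) (auto simp: mv_unit, auto simp: unit_def)

text \<open>The vector \<open>e + l c\<close>, where \<open>e = unit n\<close> and \<open>c\<close> has last coordinate \<open>0\<close>.\<close>
definition unit_plus :: "nat \<Rightarrow> 'a::field \<Rightarrow> (nat \<Rightarrow> 'a) \<Rightarrow> nat \<Rightarrow> 'a" where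
  "unit_plus n l c i = (if i < n then l * c i else 1)"

text \<open>Subtracting \<open>e \<otimes> e\<close> suitably, the difference of the two matrices, scaled by \<open>1 / l\<close> and
\<open>1 / m\<close>, kills \<open>e = unit n\<close> and acts on the quotient by \<open>e\<close> as \<open>c \<otimes> (\<psi> - \<chi>)\<close>. Since this is
nilpotent and \<open>c\<close> is good in the quotient, \<open>\<psi> = \<chi>\<close>. So \<open>W\<close> contains \<open>v \<otimes> \<psi>\<close> for two
independent vectors \<open>v\<close> of the plane spanned by \<open>c\<close> and \<open>e\<close>.\<close>
lemma same_covector:
  fixes W :: "(nat \<Rightarrow> nat \<Rightarrow> 'a::field) set"
  assumes W: "mspace (Suc n) W" and E: "outer (unit n) (unit n) \<in> W"
    and c: "good n (quot n W (unit n)) c"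
    and l: "l \<noteq> m" "l \<noteq> 0" "m \<noteq> 0"
    and \<psi>: "outer (unit_plus n l c) \<psi> \<in> W" and \<chi>: "outer (unit_plus n m c) \<chi> \<in> W"
    and eq: "\<psi> n = \<chi> n" "dot n \<psi> c = dot n \<chi> c"
  shows "outer (extend n c) \<psi> \<in> W" "outer (unit n) \<psi> \<in> W"
proof -
  define A where "A = lin2 1 (lin2 (1/l) (outer (unit_plus n l c) \<psi>) (-1/m) (outer (unit_plus n m c) \<chi>))
    (- (1/l - 1/m) * \<psi> n) (outer (unit n) (unit n))"
  have A: "A \<in> W" unfolding A_def using W \<psi> \<chi> E by (intro mspace_lin2) auto
  have "outer c (\<lambda>j. 1 * \<psi> j + (-1) * \<chi> j) \<in> quot n W (unit n)"
    using l eq by (intro quot_unitI[OF A])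
      (auto simp: A_def lin2_def outer_def unit_def unit_plus_def field_simps)
  moreover have "dot n (\<lambda>j. 1 * \<psi> j + (-1) * \<chi> j) c = 0"
    unfolding dot_comb_left using eq by simp
  ultimately have "1 * \<psi> j + (-1) * \<chi> j = 0" if "j < n" for j
    using c that unfolding good_def by blast
  then have "\<chi> j = \<psi> j" if "j < Suc n" for j
    using that eq by (auto simp: less_Suc_eq)
  then have \<chi>': "outer (unit_plus n m c) \<psi> \<in> W"
    by (intro mspace_cong[OF W \<chi>]) (simp add: outer_def)
  show 1: "outer (extend n c) \<psi> \<in> W"
    by (rule mspace_combine[OF W \<psi> \<chi>', of _ "1 / (l - m)" "- 1 / (l - m)"])
      (use l in \<open>auto simp: outer_def extend_def unit_plus_def divide_simps, auto simp: algebra_simps\<close>)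
  show "outer (unit n) \<psi> \<in> W"
    by (rule mspace_combine[OF W \<psi> 1, of _ 1 "- l"]) (auto simp: outer_def extend_def unit_plus_def unit_def)
qed

lemma infinite_three_nonzero:
  assumes "infinite (UNIV :: 'a::field set)"
  obtains a b c :: "'a::field" where "a \<noteq> b" "a \<noteq> c" "b \<noteq> c" "a \<noteq> 0" "b \<noteq> 0" "c \<noteq> 0"
proof -
  have "\<exists>x. x \<notin> F" if "finite F" for F :: "'a set"
    using ex_new_if_finite[OF assms that] .
  from this[of "{0}"] obtain a :: 'a where "a \<noteq> 0" by auto
  moreover from \<open>\<And>F. finite F \<Longrightarrow> \<exists>x. x \<notin> F\<close>[of "{0, a}"] obtain b where "b \<noteq> 0" "b \<noteq> a" by auto
  moreover from \<open>\<And>F. finite F \<Longrightarrow> \<exists>x. x \<notin> F\<close>[of "{0, a, b}"] obtain c where "c \<noteq> 0" "c \<noteq> a" "c \<noteq> b" by auto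
  ultimately show thesis using that[of a b c] by auto
qed

text \<open>The pair lemma, applied to \<open>e \<otimes> e\<close> and a matrix \<open>(e + l c) \<otimes> \<psi>\<close> of \<open>W\<close>, shows that \<open>\<psi>(e)\<close> or
\<open>\<psi>(c)\<close> is zero; the other value can be scaled to \<open>1\<close>. Among three values of \<open>l\<close> two fall
into the same case, so that \<open>same_covector\<close> applies. Since \<open>e\<close> is good, the common \<open>\<psi>\<close> must be a
multiple of \<open>e\<close>.\<close>
lemma spread_covector:
  fixes W :: "(nat \<Rightarrow> nat \<Rightarrow> 'a::field) set"
  assumes inf: "infinite (UNIV :: 'a set)" and np: "\<not> pythagorean TYPE('a)"
    and W: "maximal_qf (Suc n) W" and E: "outer (unit n) (unit n) \<in> W"
    and good: "good (Suc n) W (unit n)"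
    and c: "good n (quot n W (unit n)) c"
  shows "outer (extend n c) (unit n) \<in> W"
proof -
  have qf: "qf_space (Suc n) W" and ms: "mspace (Suc n) W"
    using W by (auto simp: maximal_qf_def qf_space_def)
  have ex: "\<exists>\<psi>. outer (unit_plus n l c) \<psi> \<in> W \<and> (\<psi> n = 0 \<and> dot n \<psi> c = 1 \<or> \<psi> n = 1 \<and> dot n \<psi> c = 0)"
    if "l \<noteq> 0" for l
  proof -
    obtain \<phi> j where \<phi>: "outer (unit_plus n l c) \<phi> \<in> W" "j < Suc n" "\<phi> j \<noteq> 0"
      by (rule maximal_rank_one[OF inf np W, where y = "unit_plus n l c"]) (auto simp: unit_plus_def)
    have scale: "outer (unit_plus n l c) (\<lambda>j. a * \<phi> j) \<in> W" for a
      by (rule mspace_combine[OF ms \<phi>(1) \<phi>(1), of _ a 0]) (simp add: outer_def)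
    have "dot n \<phi> (unit_plus n l c) = l * dot n \<phi> c"
      by (auto simp: dot_def unit_plus_def sum_distrib_left intro!: sum.cong)
    then have "dot (Suc n) \<phi> (unit_plus n l c) = l * dot n \<phi> c + \<phi> n"
      by (simp add: dot_Suc unit_plus_def)
    then have *: "\<phi> n = 0 \<or> dot n \<phi> c = 0"
      using rank_one_pair[OF np qf E \<phi>(1)] \<open>l \<noteq> 0\<close>
      by (auto simp: dot_unit dot_unit_left unit_plus_def) (simp_all add: unit_def)
    have dots: "dot n (\<lambda>j. a * \<phi> j) c = a * dot n \<phi> c" for a
      by (simp add: dot_def sum_distrib_left mult.assoc)
    show ?thesis
    proof (cases "\<phi> n = 0")
      case True
      have "outer c \<phi> \<in> quot n W (unit n)"
        using True \<open>l \<noteq> 0\<close>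
        by (intro quot_unitI[OF scale[of "1 / l"]]) (auto simp: outer_def unit_plus_def)
      then have "dot n \<phi> c \<noteq> 0"
        using c \<phi>(2,3) True unfolding good_def by (metis less_Suc_eq)
      then show ?thesis using scale[of "1 / dot n \<phi> c"] True
        by (intro exI[of _ "\<lambda>j. 1 / dot n \<phi> c * \<phi> j"]) (simp only: dots, simp)
    next
      case False
      then show ?thesis using scale[of "1 / \<phi> n"] *
        by (intro exI[of _ "\<lambda>j. 1 / \<phi> n * \<phi> j"]) (simp only: dots, simp)
    qed
  qed
  obtain l1 l2 l3 :: 'a where l: "l1 \<noteq> l2" "l1 \<noteq> l3" "l2 \<noteq> l3" "l1 \<noteq> 0" "l2 \<noteq> 0" "l3 \<noteq> 0"
    by (rule infinite_three_nonzero[OF inf])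
  obtain \<psi>1 \<psi>2 \<psi>3 where 
    1: "outer (unit_plus n l1 c) \<psi>1 \<in> W" "\<psi>1 n = 0 \<and> dot n \<psi>1 c = 1 \<or> \<psi>1 n = 1 \<and> dot n \<psi>1 c = 0" and
    2: "outer (unit_plus n l2 c) \<psi>2 \<in> W" "\<psi>2 n = 0 \<and> dot n \<psi>2 c = 1 \<or> \<psi>2 n = 1 \<and> dot n \<psi>2 c = 0" and
    3: "outer (unit_plus n l3 c) \<psi>3 \<in> W" "\<psi>3 n = 0 \<and> dot n \<psi>3 c = 1 \<or> \<psi>3 n = 1 \<and> dot n \<psi>3 c = 0"
    using ex[OF l(4)] ex[OF l(5)] ex[OF l(6)] by auto
  note same = same_covector[OF ms E c]
  have "\<exists>\<psi>. outer (extend n c) \<psi> \<in> W \<and> outer (unit n) \<psi> \<in> W \<and>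
      (\<psi> n = 0 \<and> dot n \<psi> c = 1 \<or> \<psi> n = 1 \<and> dot n \<psi> c = 0)"
    using same[OF l(1,4,5) 1(1) 2(1)] same[OF l(2,4,6) 1(1) 3(1)] same[OF l(3,5,6) 2(1) 3(1)]
      1(2) 2(2) 3(2) by auto
  then obtain \<psi> where \<psi>: "outer (extend n c) \<psi> \<in> W" "outer (unit n) \<psi> \<in> W"
    "\<psi> n = 0 \<and> dot n \<psi> c = 1 \<or> \<psi> n = 1 \<and> dot n \<psi> c = 0" by auto
  define \<chi> where "\<chi> = (\<lambda>j. \<psi> j - \<psi> n * unit n j)"
  have "outer (unit n) \<chi> \<in> W"
    by (rule mspace_combine[OF ms \<psi>(2) E, of _ 1 "- \<psi> n"]) (simp add: outer_def \<chi>_def algebra_simps)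
  moreover have "dot (Suc n) \<chi> (unit n) = 0" by (simp add: dot_unit \<chi>_def unit_def)
  ultimately have \<chi>0: "\<chi> j = 0" if "j < Suc n" for j using good that unfolding good_def by blast
  have \<psi>0: "\<psi> j = 0" if "j < n" for j
    using \<chi>0[of j] that by (simp add: \<chi>_def unit_def)
  then have "dot n \<psi> c = 0" by (simp add: dot_def)
  with \<psi>(3) have "\<psi> n = 1" by simp
  then show ?thesis
    by (intro mspace_cong[OF ms \<psi>(1)]) (auto simp: outer_def extend_def unit_def \<psi>0 less_Suc_eq)
qed

text \<open>Cofinitely many points of the moment curve are good for the quotient, and they span it; together
with \<open>unit n\<close> their images in the full space span everything.\<close>
lemma all_rank_one:
  fixes W :: "(nat \<Rightarrow> nat \<Rightarrow> 'a::field) set"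
  assumes inf: "infinite (UNIV :: 'a set)" and np: "\<not> pythagorean TYPE('a)"
    and W: "maximal_qf (Suc n) W" and E: "outer (unit n) (unit n) \<in> W"
    and good: "good (Suc n) W (unit n)"
  shows "outer y (unit n) \<in> W"
proof -
  have qf: "qf_space (Suc n) W" and ms: "mspace (Suc n) W"
    using W by (auto simp: maximal_qf_def qf_space_def)
  have q: "qf_space n (quot n W (unit n))"
    by (rule qf_space_quot[OF qf]) (simp add: unit_def)
  define S where "S = {t. good n (quot n W (unit n)) (moment n t)}"
  have un: "S \<union> {t. \<not> good n (quot n W (unit n)) (moment n t)} = UNIV" by (auto simp: S_def)
  have "infinite S"
  proof
    assume "finite S"
    from finite_UnI[OF this finite_bad_moment[OF np q]] inf show False unfolding un by simp
  qed
  from moment_span[OF this, of n "\<lambda>i. y (n - Suc i)"]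
  obtain T b where T: "finite T" "T \<subseteq> S"
    and b: "\<And>i. i < n \<Longrightarrow> (\<Sum>t\<in>T. b t * t ^ i) = y (n - Suc i)" by auto
  have v: "outer (extend n (moment n t)) (unit n) \<in> W" if "t \<in> T" for t
    using that T(2) by (intro spread_covector[OF inf np W E good]) (auto simp: S_def)
  have "outer (\<lambda>i. \<Sum>t\<in>T. b t * extend n (moment n t) i) (unit n) \<in> W"
    using E by (intro mspace_outer_sum[OF ms _ T(1) v]) auto
  moreover have "(\<Sum>t\<in>T. b t * extend n (moment n t) i) = extend n y i" for i
    using b[of "n - Suc i"] by (auto simp: extend_def moment_def)
  ultimately have "outer (extend n y) (unit n) \<in> W" by simp
  then show ?thesis
    by (rule mspace_combine[OF ms _ E, of _ _ 1 "y n"]) (auto simp: outer_def extend_def unit_def less_Suc_eq)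
qed

text \<open>Let \<open>h\<close> be a vector with last coordinate \<open>0\<close> whose image \<open>w = A h\<close> has nonzero last coordinate.
Adding \<open>outer y (unit n)\<close> changes the image of \<open>w\<close> arbitrarily and leaves that of \<open>h\<close> alone, so it
can be arranged that \<open>h \<mapsto> w \<mapsto> d h\<close> with a nonsquare \<open>d\<close>.\<close>
lemma last_row_zero:
  fixes W :: "(nat \<Rightarrow> nat \<Rightarrow> 'a::field) set"
  assumes np: "\<not> pythagorean TYPE('a)"
    and W: "qf_space (Suc n) W" and all: "\<And>y. outer y (unit n) \<in> W"
    and A: "A \<in> W" and j: "j < n"
  shows "A n j = 0"
proof (rule ccontr)
  assume r: "A n j \<noteq> 0"
  obtain d :: 'a where d: "\<And>e. e^2 \<noteq> d" by (rule non_pythagorean_nonsquare[OF np]) blast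
  define h w where "h = (unit j :: nat \<Rightarrow> 'a)" and "w = (\<lambda>i. A i j)"
  define y where "y = (\<lambda>i. (d * h i - mv (Suc n) A w i) / w n)"
  define B where "B = lin2 1 A 1 (outer y (unit n))"
  have "B \<in> W" unfolding B_def using W A all by (intro mspace_lin2) (auto simp: qf_space_def)
  then have "quad_free (Suc n) B" using W by (simp add: qf_space_def)
  moreover have "mv (Suc n) B h i = 0 * h i + w i" for i
    using j by (simp add: B_def mv_lin2 mv_outer h_def mv_unit w_def dot_unit)
      (simp add: unit_def)
  moreover have "mv (Suc n) B w i = 0 * w i + d * h i" for i
    using r by (simp add: B_def mv_lin2 mv_outer dot_unit_left y_def) (simp add: w_def)
  ultimately have "h j = 0" using quad_freeD[of "Suc n" B d h 0 w j] d j by simp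
  then show False by (simp add: h_def unit_def)
qed

section \<open>Conjugation\<close>

definition mm :: "nat \<Rightarrow> (nat \<Rightarrow> nat \<Rightarrow> 'a::field) \<Rightarrow> (nat \<Rightarrow> nat \<Rightarrow> 'a) \<Rightarrow> nat \<Rightarrow> nat \<Rightarrow> 'a" where
  "mm n A B i j = (\<Sum>k<n. A i k * B k j)"

definition id_on :: "nat \<Rightarrow> (nat \<Rightarrow> nat \<Rightarrow> 'a::field) \<Rightarrow> bool" where
  "id_on n A \<longleftrightarrow> (\<forall>i<n. \<forall>j<n. A i j = (if i = j then 1 else 0))"

definition inv_pair :: "nat \<Rightarrow> (nat \<Rightarrow> nat \<Rightarrow> 'a::field) \<Rightarrow> (nat \<Rightarrow> nat \<Rightarrow> 'a) \<Rightarrow> bool" where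
  "inv_pair n P P' \<longleftrightarrow> id_on n (mm n P P') \<and> id_on n (mm n P' P)"

lemma mm_assoc: "mm n (mm n A B) C = mm n A (mm n B C)"
proof (intro ext)
  fix i j
  show "mm n (mm n A B) C i j = mm n A (mm n B C) i j"
    unfolding mm_def sum_distrib_left sum_distrib_right
    by (subst sum.swap) (simp add: mult.assoc)
qed

lemma mv_mm: "mv n (mm n A B) v i = mv n A (mv n B v) i"
  unfolding mv_def mm_def sum_distrib_left sum_distrib_right
  by (subst sum.swap) (simp add: mult.assoc)

lemma mm_cong:
  "(\<And>k. k < n \<Longrightarrow> A i k = A' i k) \<Longrightarrow> (\<And>k. k < n \<Longrightarrow> B k j = B' k j) \<Longrightarrow> mm n A B i j = mm n A' B' i j"
  by (simp add: mm_def)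

lemma mm_id_left:
  assumes "id_on n I" "i < n" shows "mm n I A i j = A i j"
proof -
  have "mm n I A i j = (\<Sum>k<n. if k = i then A k j else 0)"
    unfolding mm_def using assms by (intro sum.cong) (auto simp: id_on_def)
  then show ?thesis using assms(2) by simp
qed

lemma mm_id_right:
  assumes "id_on n I" "j < n" shows "mm n A I i j = A i j"
proof -
  have "mm n A I i j = (\<Sum>k<n. if k = j then A i k else 0)"
    unfolding mm_def using assms by (intro sum.cong) (auto simp: id_on_def)
  then show ?thesis using assms(2) by simp
qed

lemma mv_id:
  assumes "id_on n I" "i < n" shows "mv n I v i = v i"
proof -
  have "mv n I v i = (\<Sum>k<n. if k = i then v k else 0)"
    unfolding mv_def using assms by (intro sum.cong) (auto simp: id_on_def)
  then show ?thesis using assms(2) by simp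
qed

definition conj_space :: "nat \<Rightarrow> (nat \<Rightarrow> nat \<Rightarrow> 'a::field) \<Rightarrow> (nat \<Rightarrow> nat \<Rightarrow> 'a) \<Rightarrow>
    (nat \<Rightarrow> nat \<Rightarrow> 'a) set \<Rightarrow> (nat \<Rightarrow> nat \<Rightarrow> 'a) set" where
  "conj_space n P P' W = {B. \<exists>A\<in>W. \<forall>i<n. \<forall>j<n. B i j = mm n P' (mm n A P) i j}"

lemma mm_lin2_left: "mm n (lin2 s A t B) C i j = s * mm n A C i j + t * mm n B C i j"
  by (simp add: mm_def lin2_def sum.distrib sum_distrib_left algebra_simps)

lemma mm_lin2_right: "mm n C (lin2 s A t B) i j = s * mm n C A i j + t * mm n C B i j"
  by (simp add: mm_def lin2_def sum.distrib sum_distrib_left algebra_simps)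

lemma conj_lin2: "mm n P' (mm n (lin2 s A t B) P) i j
    = s * mm n P' (mm n A P) i j + t * mm n P' (mm n B P) i j"
proof -
  have "mm n (lin2 s A t B) P = lin2 s (mm n A P) t (mm n B P)"
    by (intro ext) (simp add: mm_lin2_left lin2_def)
  then show ?thesis by (simp add: mm_lin2_right)
qed

lemma conj_back:
  assumes P: "inv_pair n P P'" and ij: "i < n" "j < n"
  shows "mm n P (mm n (mm n P' (mm n A P)) P') i j = A i j"
proof -
  have "mm n P (mm n (mm n P' (mm n A P)) P') i j = mm n (mm n P P') (mm n A (mm n P P')) i j"
    by (simp add: mm_assoc)
  also have "\<dots> = mm n A (mm n P P') i j"
    using P ij by (simp add: mm_id_left inv_pair_def)
  also have "\<dots> = A i j"
    using P ij by (simp add: mm_id_right inv_pair_def)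
  finally show ?thesis .
qed

lemma quad_free_conj:
  fixes A :: "nat \<Rightarrow> nat \<Rightarrow> 'a::field"
  assumes P: "inv_pair n P P'" and A: "quad_free n A"
    and B: "\<And>i j. i < n \<Longrightarrow> j < n \<Longrightarrow> B i j = mm n P' (mm n A P) i j"
  shows "quad_free n B"
  unfolding quad_free_def
proof (intro allI impI)
  fix \<mu> d h k i0
  assume d: "\<forall>e. e^2 \<noteq> d" and h: "\<forall>i<n. mv n B h i = \<mu> * h i + k i"
    and k: "\<forall>i<n. mv n B k i = \<mu> * k i + d * h i" and i0: "i0 < n"
  have AP: "mv n A (mv n P v) i = mv n P (mv n B v) i" if "i < n" for v i
  proof -
    have "mv n P (mv n B v) i = mv n P (mv n (mm n P' (mm n A P)) v) i"
      by (rule mv_cong[OF refl]) (rule mv_cong, simp_all add: B)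
    also have "\<dots> = mv n (mm n (mm n P P') (mm n A P)) v i"
      by (simp add: mv_mm[symmetric] mm_assoc)
    also have "\<dots> = mv n (mm n P P') (mv n (mm n A P) v) i" by (rule mv_mm)
    also have "\<dots> = mv n (mm n A P) v i" using P that by (simp add: mv_id inv_pair_def)
    finally show ?thesis by (simp add: mv_mm)
  qed
  have "mv n A (mv n P h) i = \<mu> * mv n P h i + mv n P k i" if "i < n" for i
  proof -
    have "mv n P (mv n B h) i = mv n P (\<lambda>i. \<mu> * h i + 1 * k i) i"
      by (rule mv_cong) (use h in simp_all)
    then show ?thesis by (simp only: AP[OF that] mv_comb) simp
  qed
  moreover have "mv n A (mv n P k) i = \<mu> * mv n P k i + d * mv n P h i" if "i < n" for i
  proof -
    have "mv n P (mv n B k) i = mv n P (\<lambda>i. \<mu> * k i + d * h i) i"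
      by (rule mv_cong) (use k in simp_all)
    then show ?thesis by (simp only: AP[OF that] mv_comb)
  qed
  ultimately have Ph: "mv n P h i = 0" if "i < n" for i
    using quad_freeD[OF A, of d "mv n P h" \<mu> "mv n P k" i] d that by blast
  have "h i0 = mv n (mm n P' P) h i0" using P i0 by (simp add: mv_id inv_pair_def)
  also have "\<dots> = mv n P' (mv n P h) i0" by (rule mv_mm)
  also have "\<dots> = 0" by (simp add: mv_def[of n P'] Ph)
  finally show "h i0 = 0" .
qed

lemma maximal_qf_conj:
  fixes W :: "(nat \<Rightarrow> nat \<Rightarrow> 'a::field) set"
  assumes P: "inv_pair n P P'" and W: "maximal_qf n W"
  shows "maximal_qf n (conj_space n P P' W)"
  unfolding maximal_qf_def qf_space_def mspace_def
proof (intro conjI ballI allI impI)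
  fix A B s t assume "A \<in> conj_space n P P' W" "B \<in> conj_space n P P' W"
  then obtain A' B' where AB: "A' \<in> W" "B' \<in> W"
    "\<And>i j. i < n \<Longrightarrow> j < n \<Longrightarrow> A i j = mm n P' (mm n A' P) i j"
    "\<And>i j. i < n \<Longrightarrow> j < n \<Longrightarrow> B i j = mm n P' (mm n B' P) i j"
    unfolding conj_space_def by auto
  have "lin2 s A' t B' \<in> W"
    using W AB(1,2) mspace_lin2[of n W A' B' s t] by (simp add: maximal_qf_def qf_space_def)
  moreover have "lin2 s A t B i j = mm n P' (mm n (lin2 s A' t B') P) i j" if "i < n" "j < n" for i j
    unfolding conj_lin2 using AB(3,4) that by (simp add: lin2_def)
  ultimately show "lin2 s A t B \<in> conj_space n P P' W" unfolding conj_space_def by blast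
next
  fix A B assume "A \<in> conj_space n P P' W" "\<forall>i<n. \<forall>j<n. B i j = A i j"
  then show "B \<in> conj_space n P P' W" unfolding conj_space_def by auto
next
  fix B assume "B \<in> conj_space n P P' W"
  then show "quad_free n B" using W quad_free_conj[OF P, of _ B]
    unfolding conj_space_def maximal_qf_def qf_space_def by blast
next
  fix d assume "dim_le n (conj_space n P P' W) d"
  then obtain L where L: "finite L" "card L \<le> d" "\<And>l. l \<in> L \<Longrightarrow> functional l"
    "\<And>A i j. A \<in> conj_space n P P' W \<Longrightarrow> (\<And>l. l \<in> L \<Longrightarrow> l A = 0) \<Longrightarrow> i < n \<Longrightarrow> j < n \<Longrightarrow> A i j = 0"
    by (rule dim_leE) metis
  define c where "c = (\<lambda>A. mm n P' (mm n A P))"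
  have c: "c (lin2 s A t B) = lin2 s (c A) t (c B)" for s A t B
    by (intro ext) (simp add: c_def conj_lin2 lin2_def)
  have "dim_le n W d"
  proof (rule dim_leI[where L = "(\<lambda>l A. l (c A)) ` L"])
    show "finite ((\<lambda>l A. l (c A)) ` L)" using L(1) by simp
    show "card ((\<lambda>l A. l (c A)) ` L) \<le> d"
      using card_image_le[OF L(1), of "\<lambda>l A. l (c A)"] L(2) by linarith
    show "functional l" if "l \<in> (\<lambda>l A. l (c A)) ` L" for l
      using that L(3) by (auto simp: functional_def c)
    fix A i j assume A: "A \<in> W" "\<And>l. l \<in> (\<lambda>l A. l (c A)) ` L \<Longrightarrow> l A = 0" and ij: "i < n" "j < n"
    have "c A \<in> conj_space n P P' W" using A(1) by (auto simp: conj_space_def c_def)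
    moreover have "l (c A) = 0" if "l \<in> L" for l using A(2)[of "\<lambda>A. l (c A)"] that by blast
    ultimately have c0: "c A i j = 0" if "i < n" "j < n" for i j using L(4) that by blast
    have "A i j = mm n P (mm n (c A) P') i j" using conj_back[OF P ij, of A] by (simp add: c_def)
    also have "\<dots> = 0" by (simp add: mm_def[of n P] mm_def[of n "c A"] c0)
    finally show "A i j = 0" .
  qed
  then show "tri n \<le> d" using W by (simp add: maximal_qf_def)
qed

definition block_one :: "nat \<Rightarrow> (nat \<Rightarrow> nat \<Rightarrow> 'a::field) \<Rightarrow> nat \<Rightarrow> nat \<Rightarrow> 'a" where
  "block_one n P i j = (if i < n \<and> j < n then P i j else if i = j then 1 else 0)"

lemma mm_Suc: "mm (Suc n) A B i j = mm n A B i j + A i n * B n j"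
  by (simp add: mm_def)

lemma id_block_one:
  assumes "id_on n (mm n P Q)"
  shows "id_on (Suc n) (mm (Suc n) (block_one n P) (block_one n Q))"
proof -
  have 1: "mm n (block_one n P) (block_one n Q) i j = mm n P Q i j" if "i < n" "j < n" for i j
    using that by (intro mm_cong) (auto simp: block_one_def)
  have 2: "mm n (block_one n P) (block_one n Q) n j = 0" for j
    by (simp add: mm_def block_one_def)
  have 3: "mm n (block_one n P) (block_one n Q) i n = 0" for i
    by (simp add: mm_def block_one_def)
  show ?thesis
    unfolding id_on_def mm_Suc
    using assms by (auto simp: less_Suc_eq 1 2 3 id_on_def) (auto simp: block_one_def)
qed

lemma inv_pair_block_one: "inv_pair n P P' \<Longrightarrow> inv_pair (Suc n) (block_one n P) (block_one n P')"
  by (simp add: inv_pair_def id_block_one)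

lemma inv_pair_mm:
  assumes "inv_pair n P P'" "inv_pair n Q Q'"
  shows "inv_pair n (mm n P Q) (mm n Q' P')"
proof -
  have "id_on n (mm n (mm n P Q) (mm n Q' P'))" if "inv_pair n P P'" "inv_pair n Q Q'" for P P' Q Q'
    unfolding id_on_def
  proof (intro allI impI)
    fix i j assume ij: "i < n" "j < n"
    have "mm n (mm n P Q) (mm n Q' P') i j = mm n P (mm n (mm n Q Q') P') i j"
      by (simp add: mm_assoc)
    also have "\<dots> = mm n P P' i j"
      using that(2) by (intro mm_cong) (auto simp: inv_pair_def mm_id_left)
    finally show "mm n (mm n P Q) (mm n Q' P') i j = (if i = j then 1 else 0)"
      using that(1) ij by (simp add: inv_pair_def id_on_def)
  qed
  from this[OF assms] this[of Q' Q P' P] assms show ?thesis by (auto simp: inv_pair_def)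
qed

text \<open>The last column of \<open>P\<close> is \<open>y\<close>, and its other columns are the projections
\<open>e\<^sub>j - \<phi>\<^sub>j y\<close> of the standard basis vectors to the kernel of \<open>\<phi>\<close>.\<close>
lemma adapted_basis:
  fixes u :: "nat \<Rightarrow> 'a::field"
  assumes y: "y n = 1" and \<phi>: "dot (Suc n) \<phi> y = 1"
  obtains P P' where "inv_pair (Suc n) P P'" "\<And>i. P i n = y i" "\<And>j. P' n j = \<phi> j"
proof -
  define P where "P = (\<lambda>i j. if j = n then y i else (if i = j then 1 else 0) - y i * \<phi> j)"
  define P' where "P' = (\<lambda>i j. if i = n then \<phi> j else if j = n then - y i else if i = j then 1 else 0)"
  have a: "dot n \<phi> y = 1 - \<phi> n" using \<phi> y by (simp add: dot_Suc algebra_simps)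
  have "mm n P P' i j = (if i < n then P' i j else 0) - y i * (\<Sum>k<n. \<phi> k * P' k j)" for i j
  proof -
    have "mm n P P' i j = (\<Sum>k<n. (if i = k then P' k j else 0) - y i * (\<phi> k * P' k j))"
      unfolding mm_def by (intro sum.cong) (auto simp: P_def left_diff_distrib mult.assoc)
    then show ?thesis by (simp add: sum_subtractf sum_distrib_left)
  qed
  moreover have "(\<Sum>k<n. \<phi> k * P' k j) = (if j < n then \<phi> j else 0)" if "j \<noteq> n" for j
  proof -
    have "(\<Sum>k<n. \<phi> k * P' k j) = (\<Sum>k<n. if j = k then \<phi> k else 0)"
      using that by (intro sum.cong) (auto simp: P'_def)
    then show ?thesis by simp
  qed
  moreover have "(\<Sum>k<n. \<phi> k * P' k n) = \<phi> n - 1"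
  proof -
    have "(\<Sum>k<n. \<phi> k * P' k n) = - dot n \<phi> y"
      by (simp add: P'_def dot_def sum_negf)
    then show ?thesis by (simp add: a)
  qed
  ultimately have 1: "id_on (Suc n) (mm (Suc n) P P')"
    unfolding id_on_def mm_Suc using y
    by (auto simp: less_Suc_eq) (auto simp: P_def P'_def algebra_simps)
  have PPn: "mm n P' P i j = (if i < n then P i j else 0)" if "i \<noteq> n" for i j
  proof -
    have "mm n P' P i j = (\<Sum>k<n. if i = k then P k j else 0)"
      unfolding mm_def using that by (intro sum.cong) (auto simp: P'_def)
    then show ?thesis by simp
  qed
  have PPj: "mm n P' P n j = \<phi> j * \<phi> n" if "j < n" for j
  proof -
    have "mm n P' P n j = (\<Sum>k<n. (if j = k then \<phi> k else 0) - \<phi> k * y k * \<phi> j)"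
      unfolding mm_def using that by (intro sum.cong) (auto simp: P_def P'_def algebra_simps)
    also have "\<dots> = \<phi> j - dot n \<phi> y * \<phi> j"
      using that by (simp add: sum_subtractf dot_def sum_distrib_right)
    finally show ?thesis by (simp add: a algebra_simps)
  qed
  have PPnn: "mm n P' P n n = 1 - \<phi> n"
    by (simp add: mm_def P_def P'_def dot_def[symmetric] a)
  have 2: "id_on (Suc n) (mm (Suc n) P' P)"
    unfolding id_on_def mm_Suc
    by (auto simp: less_Suc_eq PPn PPj PPnn) (auto simp: P_def P'_def y algebra_simps)
  show thesis
    by (rule that[of P P']) (use 1 2 in \<open>auto simp: inv_pair_def P_def P'_def\<close>)
qed

section \<open>Simultaneous triangularization\<close>

definition vm :: "nat \<Rightarrow> (nat \<Rightarrow> 'a::field) \<Rightarrow> (nat \<Rightarrow> nat \<Rightarrow> 'a) \<Rightarrow> nat \<Rightarrow> 'a" where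
  "vm n \<phi> B j = (\<Sum>k<n. \<phi> k * B k j)"

lemma mm_outer_right: "mm n A (outer x \<phi>) = outer (mv n A x) \<phi>"
  by (intro ext) (simp add: mm_def outer_def mv_def sum_distrib_right mult.assoc)

lemma mm_outer_left: "mm n (outer x \<phi>) B = outer x (vm n \<phi> B)"
  by (intro ext) (simp add: mm_def outer_def vm_def sum_distrib_left mult.assoc)

lemma dot_vm: "dot n (vm n \<phi> B) v = dot n \<phi> (mv n B v)"
  unfolding dot_def vm_def mv_def sum_distrib_left sum_distrib_right
  by (subst sum.swap) (simp add: mult.assoc)

lemma vm_vm: "vm n (vm n \<phi> A) B j = vm n \<phi> (mm n A B) j"
  unfolding vm_def mm_def sum_distrib_left sum_distrib_right
  by (subst sum.swap) (simp add: mult.assoc)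

lemma vm_id:
  assumes "id_on n I" "j < n" shows "vm n \<phi> I j = \<phi> j"
proof -
  have "vm n \<phi> I j = (\<Sum>k<n. if k = j then \<phi> k else 0)"
    unfolding vm_def using assms by (intro sum.cong) (auto simp: id_on_def)
  then show ?thesis using assms(2) by simp
qed

lemma good_conj:
  fixes P :: "nat \<Rightarrow> nat \<Rightarrow> 'a::field"
  assumes P: "inv_pair n P P'" and W: "mspace n W" and x: "good n W (mv n P x)"
  shows "good n (conj_space n P P' W) x"
  unfolding good_def
proof (intro allI impI)
  fix \<psi> j assume o: "outer x \<psi> \<in> conj_space n P P' W" and d: "dot n \<psi> x = 0" and j: "j < n"
  from o obtain A where A: "A \<in> W"
    "\<And>i j. i < n \<Longrightarrow> j < n \<Longrightarrow> outer x \<psi> i j = mm n P' (mm n A P) i j"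
    unfolding conj_space_def by auto
  have "outer (mv n P x) (vm n \<psi> P') i j = A i j" if "i < n" "j < n" for i j
  proof -
    have "outer (mv n P x) (vm n \<psi> P') i j = mm n P (mm n (outer x \<psi>) P') i j"
      by (simp add: mm_outer_left mm_outer_right)
    also have "\<dots> = mm n P (mm n (mm n P' (mm n A P)) P') i j"
      using that by (intro mm_cong refl) (auto simp: A(2))
    also have "\<dots> = A i j" by (rule conj_back[OF P that])
    finally show ?thesis .
  qed
  then have "outer (mv n P x) (vm n \<psi> P') \<in> W" using mspace_cong[OF W A(1)] by blast
  moreover have "dot n (vm n \<psi> P') (mv n P x) = 0"
  proof -
    have "dot n \<psi> (mv n P' (mv n P x)) = dot n \<psi> x"
      using P by (intro dot_cong) (simp_all add: mv_mm[symmetric] mv_id inv_pair_def)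
    then show ?thesis using d by (simp add: dot_vm)
  qed
  ultimately have z: "vm n \<psi> P' k = 0" if "k < n" for k using x that unfolding good_def by blast
  have "\<psi> j = vm n (vm n \<psi> P') P j" using P j by (simp add: vm_vm vm_id inv_pair_def)
  also have "\<dots> = 0" by (simp add: vm_def[of n "vm n \<psi> P'"] z)
  finally show "\<psi> j = 0" .
qed

definition corner :: "nat \<Rightarrow> (nat \<Rightarrow> nat \<Rightarrow> 'a::field) set \<Rightarrow> (nat \<Rightarrow> nat \<Rightarrow> 'a) set" where
  "corner n W = {B. \<exists>A\<in>W. \<forall>i<n. \<forall>j<n. B i j = A i j}"

text \<open>The \<open>n + 1\<close> entries of the last column are the only other nonzero entries of a matrix in \<open>W\<close>, so the corner
loses at most \<open>n + 1 = tri (Suc n) - tri n\<close> dimensions.\<close>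
lemma maximal_qf_corner:
  fixes W :: "(nat \<Rightarrow> nat \<Rightarrow> 'a::field) set"
  assumes W: "maximal_qf (Suc n) W" and row: "\<And>A j. A \<in> W \<Longrightarrow> j < n \<Longrightarrow> A n j = 0"
  shows "maximal_qf n (corner n W)"
  unfolding maximal_qf_def qf_space_def mspace_def
proof (intro conjI ballI allI impI)
  fix A B s t assume "A \<in> corner n W" "B \<in> corner n W"
  then obtain A' B' where AB: "A' \<in> W" "B' \<in> W"
    "\<And>i j. i < n \<Longrightarrow> j < n \<Longrightarrow> A i j = A' i j" "\<And>i j. i < n \<Longrightarrow> j < n \<Longrightarrow> B i j = B' i j"
    unfolding corner_def by auto
  have "lin2 s A' t B' \<in> W"
    using W AB(1,2) mspace_lin2[of "Suc n" W A' B' s t] by (simp add: maximal_qf_def qf_space_def)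
  moreover have "lin2 s A t B i j = lin2 s A' t B' i j" if "i < n" "j < n" for i j
    using AB(3,4) that by (simp add: lin2_def)
  ultimately show "lin2 s A t B \<in> corner n W" unfolding corner_def by blast
next
  fix A B assume "A \<in> corner n W" "\<forall>i<n. \<forall>j<n. B i j = A i j"
  then show "B \<in> corner n W" unfolding corner_def by auto
next
  fix B assume "B \<in> corner n W"
  then obtain A where A: "A \<in> W" and B: "\<And>i j. i < n \<Longrightarrow> j < n \<Longrightarrow> B i j = A i j"
    unfolding corner_def by auto
  have qA: "quad_free (Suc n) A" using W A by (simp add: maximal_qf_def qf_space_def)
  show "quad_free n B"
    unfolding quad_free_def
  proof (intro allI impI)
    fix \<mu> d h k i0
    assume d: "\<forall>e. e^2 \<noteq> d" and h: "\<forall>i<n. mv n B h i = \<mu> * h i + k i"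
      and k: "\<forall>i<n. mv n B k i = \<mu> * k i + d * h i" and i0: "i0 < n"
    have Aext: "mv (Suc n) A (extend n v) i = extend n (mv n B v) i" if "i < Suc n" for v i
      unfolding mv_Suc_extend using that row[OF A]
      by (auto simp: mv_def B extend_def less_Suc_eq)
    have "extend n h i0 = 0"
    proof (rule quad_freeD[OF qA])
      show "e^2 \<noteq> d" for e using d by blast
      show "mv (Suc n) A (extend n h) i = \<mu> * extend n h i + extend n k i" if "i < Suc n" for i
        unfolding Aext[OF that] using h that by (auto simp: extend_def)
      show "mv (Suc n) A (extend n k) i = \<mu> * extend n k i + d * extend n h i" if "i < Suc n" for i
        unfolding Aext[OF that] using k that by (auto simp: extend_def)
      show "i0 < Suc n" using i0 by simp
    qed
    then show "h i0 = 0" using i0 by (simp add: extend_lt)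
  qed
next
  fix d assume "dim_le n (corner n W) d"
  then obtain L where L: "finite L" "card L \<le> d" "\<And>l. l \<in> L \<Longrightarrow> functional l"
    "\<And>A i j. A \<in> corner n W \<Longrightarrow> (\<And>l. l \<in> L \<Longrightarrow> l A = 0) \<Longrightarrow> i < n \<Longrightarrow> j < n \<Longrightarrow> A i j = 0"
    by (rule dim_leE) metis
  define c where "c = (\<lambda>i (A :: nat \<Rightarrow> nat \<Rightarrow> 'a). A i n)"
  have "dim_le (Suc n) W (d + Suc n)"
  proof (rule dim_leI[where L = "L \<union> c ` {..<Suc n}"])
    show "finite (L \<union> c ` {..<Suc n})" using L(1) by simp
    show "card (L \<union> c ` {..<Suc n}) \<le> d + Suc n"
    proof -
      have "card (c ` {..<Suc n}) \<le> Suc n" using card_image_le[of "{..<Suc n}" c] by simp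
      then show ?thesis using card_Un_le[of L "c ` {..<Suc n}"] L(2) by linarith
    qed
    show "functional l" if "l \<in> L \<union> c ` {..<Suc n}" for l
      using that L(3) by (auto simp: functional_def c_def lin2_def)
    fix A i j assume A: "A \<in> W" "\<And>l. l \<in> L \<union> c ` {..<Suc n} \<Longrightarrow> l A = 0"
      and ij: "i < Suc n" "j < Suc n"
    have "A i n = 0" using A(2)[of "c i"] ij(1) by (simp add: c_def)
    moreover have "A i j = 0" if "i < n" "j < n"
      by (rule L(4)[OF _ _ that]) (use A in \<open>auto simp: corner_def\<close>)
    ultimately show "A i j = 0" using row[OF A(1), of j] ij by (auto simp: less_Suc_eq)
  qed
  then have "tri (Suc n) \<le> d + Suc n" using W by (simp only: maximal_qf_def)
  then show "tri n \<le> d" by simp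
qed

text \<open>A good \<open>y\<close> and \<open>\<phi>\<close> with \<open>\<phi>(y) = 1\<close> and \<open>outer y \<phi>\<close> in \<open>W\<close> are moved to \<open>unit n\<close> by a
conjugation. Then the last rows vanish off the diagonal and induction applies to the corner.\<close>
theorem maximal_qf_triangular:
  fixes W :: "(nat \<Rightarrow> nat \<Rightarrow> 'a::field) set"
  assumes inf: "infinite (UNIV :: 'a set)" and np: "\<not> pythagorean TYPE('a)"
  shows "maximal_qf n W \<Longrightarrow>
    \<exists>P P'. inv_pair n P P' \<and> (\<forall>A\<in>W. \<forall>i<n. \<forall>j<i. mm n P' (mm n A P) i j = 0)"
proof (induction n arbitrary: W)
  case 0
  show ?case by (simp add: inv_pair_def id_on_def)
next
  case (Suc n)
  let ?N = "Suc n"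
  have qf: "qf_space ?N W" and ms: "mspace ?N W"
    using Suc.prems by (auto simp: maximal_qf_def qf_space_def)
  obtain t where t: "good ?N W (moment ?N t)"
    by (rule exists_good_moment[OF inf np qf])
  define y where "y = moment ?N t"
  have y: "y n = 1" by (simp add: y_def moment_def)
  obtain \<phi>0 j where \<phi>0: "outer y \<phi>0 \<in> W" "j < ?N" "\<phi>0 j \<noteq> 0"
    by (rule maximal_rank_one[OF inf np Suc.prems, where y = y]) (use y in auto)
  have d0: "dot ?N \<phi>0 y \<noteq> 0" using t \<phi>0 unfolding good_def y_def by blast
  define \<phi> where "\<phi> = (\<lambda>j. \<phi>0 j / dot ?N \<phi>0 y)"
  have \<phi>: "outer y \<phi> \<in> W"
    by (rule mspace_combine[OF ms \<phi>0(1) \<phi>0(1), of _ "1 / dot ?N \<phi>0 y" 0])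
      (simp add: outer_def \<phi>_def)
  have "dot ?N \<phi> y = dot ?N \<phi>0 y / dot ?N \<phi>0 y"
    unfolding \<phi>_def dot_def[of _ "\<lambda>j. \<phi>0 j / _"] by (simp add: sum_divide_distrib[symmetric] dot_def[symmetric])
  then have "dot ?N \<phi> y = 1" using d0 by simp
  with y obtain P P' where P: "inv_pair ?N P P'" and Py: "\<And>i. P i n = y i" and P\<phi>: "\<And>j. P' n j = \<phi> j"
    by (rule adapted_basis) auto
  define V where "V = conj_space ?N P P' W"
  have V: "maximal_qf ?N V" unfolding V_def by (rule maximal_qf_conj[OF P Suc.prems])
  have Pn: "mv ?N P (unit n) = y" by (intro ext) (simp add: mv_unit Py)
  have "good ?N V (unit n)"
    unfolding V_def by (rule good_conj[OF P ms]) (use t in \<open>simp add: Pn y_def\<close>)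
  moreover have E: "outer (unit n) (unit n) \<in> V"
  proof -
    have "mv ?N P' y i = unit n i" if "i < ?N" for i
      using P that unfolding Pn[symmetric] mv_mm[symmetric] by (simp add: mv_id inv_pair_def)
    moreover have "vm ?N \<phi> P j = unit n j" if "j < ?N" for j
    proof -
      have "vm ?N \<phi> P j = mm ?N P' P n j" by (simp add: vm_def mm_def P\<phi>)
      then show ?thesis using P that by (auto simp: inv_pair_def id_on_def unit_def)
    qed
    ultimately show ?thesis
      unfolding V_def conj_space_def using \<phi>
      by (intro CollectI bexI[of _ "outer y \<phi>"]) (simp_all add: mm_outer_left mm_outer_right, simp add: outer_def)
  qed
  ultimately have all: "outer v (unit n) \<in> V" for v
    using all_rank_one[OF inf np V] by blast
  have row: "A n j = 0" if "A \<in> V" "j < n" for A j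
    using last_row_zero[OF np _ all that] V by (simp add: maximal_qf_def)
  have "maximal_qf n (corner n V)" by (rule maximal_qf_corner[OF V]) (rule row)
  from Suc.IH[OF this] obtain Q Q' where Q: "inv_pair n Q Q'"
    and tri: "\<And>A i j. A \<in> corner n V \<Longrightarrow> i < n \<Longrightarrow> j < i \<Longrightarrow> mm n Q' (mm n A Q) i j = 0" by blast
  let ?R = "block_one n Q" and ?R' = "block_one n Q'"
  have "inv_pair ?N (mm ?N P ?R) (mm ?N ?R' P')"
    by (rule inv_pair_mm[OF P inv_pair_block_one[OF Q]])
  moreover have "mm ?N (mm ?N ?R' P') (mm ?N A (mm ?N P ?R)) i j = 0"
    if A: "A \<in> W" and ij: "i < ?N" "j < i" for A i j
  proof -
    define B where "B = mm ?N P' (mm ?N A P)"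
    have B: "B \<in> V" using A by (auto simp: V_def conj_space_def B_def)
    then have "B \<in> corner n V" by (auto simp: corner_def)
    have j: "j < n" using ij by simp
    have BR: "mm ?N B ?R i j = mm n B Q i j" for i
      using j by (simp add: mm_def block_one_def)
    have "mm ?N ?R' (mm ?N B ?R) i j = 0"
    proof (cases "i = n")
      case True
      have "mm n B Q n j = 0" by (simp add: mm_def row[OF B])
      then show ?thesis using True by (simp add: mm_Suc[of n ?R'] BR) (simp add: mm_def block_one_def)
    next
      case False
      then have i: "i < n" using ij by simp
      have "mm ?N ?R' (mm ?N B ?R) i j = mm n Q' (mm n B Q) i j"
        using i by (simp add: mm_Suc[of n ?R']) (simp add: mm_def[of n Q'] mm_def[of n ?R'] BR block_one_def)
      then show ?thesis using tri[OF \<open>B \<in> corner n V\<close> i ij(2)] by simp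
    qed
    then show ?thesis by (simp add: B_def mm_assoc)
  qed
  ultimately show ?case by blast
qed

text \<open>Positions are listed as (column, row), which makes the set a dependent sum over the columns.\<close>
definition upper_positions :: "nat \<Rightarrow> (nat \<times> nat) set" where
  "upper_positions n = (SIGMA j:{..<n}. {..j})"

lemma finite_upper_positions: "finite (upper_positions n)"
  by (simp add: upper_positions_def)

lemma card_upper_positions: "card (upper_positions n) = tri n"
proof -
  have "card (upper_positions n) = (\<Sum>j<n. Suc j)" by (simp add: upper_positions_def)
  also have "\<dots> = tri n" by (induction n) simp_all
  finally show ?thesis .
qed

text \<open>If the matrix unit at some position \<open>(p, q)\<close> on or above the diagonal were missing from \<open>W\<close>, the entries at the
other such positions would determine the elements of \<open>W\<close>, one form fewer than the
dimension.\<close>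
lemma maximal_qf_all_triangular:
  fixes W :: "(nat \<Rightarrow> nat \<Rightarrow> 'a::field) set"
  assumes W: "maximal_qf n W" and n: "0 < n" and tri: "\<And>A i j. A \<in> W \<Longrightarrow> i < n \<Longrightarrow> j < i \<Longrightarrow> A i j = 0"
    and B: "\<And>i j. i < n \<Longrightarrow> j < i \<Longrightarrow> B i j = 0"
  shows "B \<in> W"
proof -
  have ms: "mspace n W" using W by (simp add: maximal_qf_def qf_space_def)
  define S where "S = upper_positions n"
  have S: "finite S" "card S = tri n"
    by (simp_all add: S_def finite_upper_positions card_upper_positions)
  have unit: "outer (unit p) (unit q) \<in> W" if pq: "p \<le> q" "q < n" for p q
  proof (rule ccontr)
    assume no: "outer (unit p) (unit q) \<notin> W"
    define e where "e = (\<lambda>(j, i) (A :: nat \<Rightarrow> nat \<Rightarrow> 'a). A i j)"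
    have "dim_le n W (tri n - 1)"
    proof (rule dim_leI[where L = "e ` (S - {(q, p)})"])
      have "card (S - {(q, p)}) = tri n - 1" using S pq by (simp add: S_def upper_positions_def)
      then show "card (e ` (S - {(q, p)})) \<le> tri n - 1"
        using card_image_le[of "S - {(q, p)}" e] S by simp
      show "functional l" if "l \<in> e ` (S - {(q, p)})" for l
        using that by (auto simp: functional_def e_def lin2_def)
      fix A i j assume A: "A \<in> W" "\<And>l. l \<in> e ` (S - {(q, p)}) \<Longrightarrow> l A = 0" and ij: "i < n" "j < n"
      have z: "A i j = 0" if "i < n" "j < n" "(i, j) \<noteq> (p, q)" for i j
      proof (cases "j < i")
        case True
        then show ?thesis using tri[OF A(1)] that(1) by blast
      next
        case False
        then have "(j, i) \<in> S - {(q, p)}" using that by (auto simp: S_def upper_positions_def)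
        from A(2)[OF imageI[OF this]] show ?thesis by (simp add: e_def)
      qed
      have "A p q = 0"
      proof (rule ccontr)
        assume "A p q \<noteq> 0"
        have "outer (unit p) (unit q) \<in> W"
          by (rule mspace_combine[OF ms A(1) A(1), of _ "1 / A p q" 0])
            (use \<open>A p q \<noteq> 0\<close> z in \<open>auto simp: outer_def unit_def\<close>)
        with no show False ..
      qed
      with z ij show "A i j = 0" by (cases "(i, j) = (p, q)") auto
    qed (use S in auto)
    then have "tri n \<le> tri n - 1" using W by (simp only: maximal_qf_def)
    moreover have "card S \<noteq> 0" using S(1) pq by (auto simp: S_def upper_positions_def)
    ultimately show False using S(2) by simp
  qed
  have "(\<lambda>i j. if (j, i) \<in> J then B i j else 0) \<in> W" if "finite J" "J \<subseteq> S" for J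
    using that
  proof (induction J rule: finite_induct)
    case empty
    show ?case by (rule mspace_combine[OF ms unit[OF le_refl n] unit[OF le_refl n], of _ 0 0]) simp
  next
    case (insert p J)
    obtain j i where p: "p = (j, i)" by force
    have "outer (unit i) (unit j) \<in> W" using insert.prems p by (intro unit) (auto simp: S_def upper_positions_def)
    moreover have "(\<lambda>i j. if (j, i) \<in> J then B i j else 0) \<in> W" using insert by simp
    ultimately show ?case
      by (rule mspace_combine[OF ms, of _ _ _ "B i j" 1])
        (use insert.hyps p in \<open>auto simp: outer_def unit_def\<close>)
  qed
  from this[OF S(1) subset_refl] show ?thesis
    by (rule mspace_cong[OF ms]) (use B in \<open>auto simp: S_def upper_positions_def\<close>)
qed

text \<open>At the last index where \<open>h\<close> or \<open>k\<close> is nonzero the equations involve only the diagonal entry \<open>b\<close>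
of \<open>B\<close> and give \<open>(b - \<mu>)\<^sup>2 = d\<close>.\<close>
lemma quad_free_upper_triangular:
  fixes B :: "nat \<Rightarrow> nat \<Rightarrow> 'a::field"
  assumes B: "\<And>i j. i < n \<Longrightarrow> j < i \<Longrightarrow> B i j = 0"
  shows "quad_free n B"
  unfolding quad_free_def
proof (intro allI impI)
  fix \<mu> d h k i0
  assume d: "\<forall>e. e^2 \<noteq> d" and h: "\<forall>i<n. mv n B h i = \<mu> * h i + k i"
    and k: "\<forall>i<n. mv n B k i = \<mu> * k i + d * h i" and i0: "i0 < n"
  have "h i = 0 \<and> k i = 0" if "i < n" for i
    using that
  proof (induction "n - i" arbitrary: i rule: less_induct)
    case less
    have later: "h j = 0" "k j = 0" if "i < j" "j < n" for j
      using less.hyps[of j] that by auto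
    have diag: "mv n B v i = B i i * v i" if "\<And>j. i < j \<Longrightarrow> j < n \<Longrightarrow> v j = 0" for v
    proof -
      have "mv n B v i = (\<Sum>j<n. if j = i then B i i * v i else 0)"
        unfolding mv_def
      proof (rule sum.cong[OF refl])
        fix j assume "j \<in> {..<n}"
        then show "B i j * v j = (if j = i then B i i * v i else 0)"
          using B[OF less.prems, of j] that[of j] by (cases i j rule: linorder_cases) auto
      qed
      then show ?thesis using less.prems by simp
    qed
    have 1: "k i = (B i i - \<mu>) * h i"
      using h less.prems diag[of h] later by (simp add: algebra_simps)
    have "(B i i - \<mu>) * k i = d * h i"
      using k less.prems diag[of k] later by (simp add: algebra_simps)
    then have "((B i i - \<mu>)^2 - d) * h i = 0"
      unfolding 1 by (simp add: algebra_simps power2_eq_square)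
    then have "h i = 0" using d by auto
    with 1 show ?case by simp
  qed
  then show "h i0 = 0" using i0 by blast
qed

section \<open>Translation to subspaces of matrices\<close>

text \<open>Fewer homogeneous linear equations than unknowns have a nontrivial solution: an equation with a
nonzero coefficient is used to eliminate one unknown.\<close>
lemma linear_dependency:
  fixes f :: "'l \<Rightarrow> 's \<Rightarrow> 'a::field"
  assumes "finite L" "finite S" "card L < card S"
  shows "\<exists>a. (\<exists>s\<in>S. a s \<noteq> 0) \<and> (\<forall>l\<in>L. (\<Sum>s\<in>S. a s * f l s) = 0)"
  using assms
proof (induction L arbitrary: S f rule: finite_induct)
  case empty
  then have "S \<noteq> {}" by auto
  then show ?case by (intro exI[of _ "\<lambda>_. 1"]) auto
next
  case (insert l L)
  show ?case
  proof (cases "\<forall>s\<in>S. f l s = 0")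
    case True
    have "card L < card S" using insert by simp
    from insert.IH[OF insert.prems(1) this, of f] obtain a where
      "\<exists>s\<in>S. a s \<noteq> 0" "\<forall>l\<in>L. (\<Sum>s\<in>S. a s * f l s) = 0" by auto
    with True show ?thesis by (intro exI[of _ a]) simp
  next
    case False
    then obtain s0 where s0: "s0 \<in> S" "f l s0 \<noteq> 0" by auto
    define T where "T = S - {s0}"
    have T: "finite T" "card L < card T" "s0 \<notin> T" "S = insert s0 T"
      using insert s0 by (auto simp: T_def)
    from insert.IH[OF T(1,2), of "\<lambda>m s. f m s - f m s0 * f l s / f l s0"]
    obtain a where a: "\<exists>s\<in>T. a s \<noteq> 0"
      "\<And>m. m \<in> L \<Longrightarrow> (\<Sum>s\<in>T. a s * (f m s - f m s0 * f l s / f l s0)) = 0" by auto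
    define r where "r = (\<Sum>s\<in>T. a s * f l s)"
    define b where "b = a(s0 := - r / f l s0)"
    have sum: "(\<Sum>s\<in>S. b s * f m s) = - r / f l s0 * f m s0 + (\<Sum>s\<in>T. a s * f m s)" for m
    proof -
      have "(\<Sum>s\<in>T. b s * f m s) = (\<Sum>s\<in>T. a s * f m s)"
        using T(3) by (intro sum.cong) (auto simp: b_def)
      then show ?thesis unfolding T(4) using T(1,3) by (simp add: b_def)
    qed
    have "(\<Sum>s\<in>S. b s * f m s) = 0" if "m \<in> L" for m
    proof -
      have "0 = (\<Sum>s\<in>T. a s * f m s - f m s0 / f l s0 * (a s * f l s))"
        unfolding a(2)[OF that, symmetric] by (intro sum.cong) (auto simp: algebra_simps)
      also have "\<dots> = (\<Sum>s\<in>T. a s * f m s) - f m s0 / f l s0 * r"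
        by (simp add: sum_subtractf r_def sum_distrib_left)
      finally show ?thesis by (simp add: sum algebra_simps)
    qed
    moreover have "(\<Sum>s\<in>S. b s * f l s) = 0" using s0(2) by (simp add: sum r_def)
    moreover have "\<exists>s\<in>S. b s \<noteq> 0" using a(1) T(3,4) by (auto simp: b_def)
    ultimately show ?thesis by auto
  qed
qed

lemma functional_sum:
  fixes l :: "(nat \<Rightarrow> nat \<Rightarrow> 'a::field) \<Rightarrow> 'a"
  assumes l: "functional l" and "finite B"
  shows "l (\<lambda>i j. \<Sum>b\<in>B. a b * g b i j) = (\<Sum>b\<in>B. a b * l (g b))"
  using assms(2)
proof (induction B rule: finite_induct)
  case empty
  have "l (lin2 0 (\<lambda>_ _. 0) 0 (\<lambda>_ _. 0)) = 0" using l unfolding functional_def by simp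
  also have "lin2 0 (\<lambda>_ _. 0) 0 (\<lambda>_ _. 0) = (\<lambda>_ _. 0 :: 'a)" by (intro ext) (simp add: lin2_def)
  finally show ?case by simp
next
  case (insert b B)
  have "(\<lambda>i j. \<Sum>b\<in>insert b B. a b * g b i j) = lin2 (a b) (g b) 1 (\<lambda>i j. \<Sum>b\<in>B. a b * g b i j)"
    using insert.hyps by (intro ext) (simp add: lin2_def)
  then show ?case using l insert unfolding functional_def by simp
qed

definition entries :: "nat \<Rightarrow> 'a::field mat set \<Rightarrow> (nat \<Rightarrow> nat \<Rightarrow> 'a) set" where
  "entries n W = {A. mat n n (\<lambda>(i, j). A i j) \<in> W}"

lemma mat_subspace_closed:
  assumes "mat_subspace n W"
  shows "W \<subseteq> carrier_mat n n" "\<And>A B. A \<in> W \<Longrightarrow> B \<in> W \<Longrightarrow> A + B \<in> W"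
    "\<And>c A. A \<in> W \<Longrightarrow> c \<cdot>\<^sub>m A \<in> W"
  using assms unfolding mat_subspace_def subspace_def submodule_def
  by (auto simp: module_mat_simps)

lemma mspace_entries:
  assumes "mat_subspace n W"
  shows "mspace n (entries n W)"
  unfolding mspace_def
proof (intro conjI ballI allI impI)
  fix A B s t assume "A \<in> entries n W" "B \<in> entries n W"
  then have "s \<cdot>\<^sub>m mat n n (\<lambda>(i, j). A i j) + t \<cdot>\<^sub>m mat n n (\<lambda>(i, j). B i j) \<in> W"
    using mat_subspace_closed[OF assms] by (simp add: entries_def)
  moreover have "s \<cdot>\<^sub>m mat n n (\<lambda>(i, j). A i j) + t \<cdot>\<^sub>m mat n n (\<lambda>(i, j). B i j)
      = mat n n (\<lambda>(i, j). lin2 s A t B i j)"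
    by (intro eq_matI) (auto simp: lin2_def)
  ultimately show "lin2 s A t B \<in> entries n W" by (simp add: entries_def)
next
  fix A B assume "A \<in> entries n W" "\<forall>i<n. \<forall>j<n. B i j = A i j"
  moreover from this have "mat n n (\<lambda>(i, j). B i j) = mat n n (\<lambda>(i, j). A i j)"
    by (intro eq_matI) auto
  ultimately show "B \<in> entries n W" by (simp add: entries_def)
qed

text \<open>Linear forms without a common zero bound the size of independent subsets, since \<open>linear_dependency\<close>
gives every larger set a combination on which all forms vanish. Hence a maximal independent set
exists, and it is a basis of the stated size.\<close>
lemma mat_subspace_basis:
  fixes W :: "'a::field mat set"
  assumes W: "mat_subspace n W" and d: "dim_le n (entries n W) d"
  obtains G where "finite G" "G \<subseteq> W" "card G = mat_subspace_dim n W" "card G \<le> d"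
    "\<And>M. M \<in> W \<Longrightarrow> \<exists>c. M = mat n n (\<lambda>p. \<Sum>g\<in>G. c g * g $$ p)"
proof -
  let ?V = "module_mat TYPE('a) n n"
  let ?W = "?V\<lparr>carrier := W\<rparr>"
  interpret V: vectorspace "class_ring :: 'a ring" ?V by (rule matrix_vs)
  have sub: "VectorSpace.subspace class_ring W ?V" using W by (simp add: mat_subspace_def)
  interpret W: vectorspace "class_ring :: 'a ring" ?W by (rule V.subspace_is_vs[OF sub])
  note closed = mat_subspace_closed[OF W]
  have lincomb: "W.lincomb a B = mat n n (\<lambda>p. \<Sum>b\<in>B. a b * b $$ p)"
    if "finite B" "B \<subseteq> W" for a B
    using that
  proof (induction B rule: finite_induct)
    case empty
    have "\<zero>\<^bsub>?W\<^esub> = mat n n (\<lambda>p. 0)" by (auto simp: module_mat_simps zero_mat_def)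
    then show ?case by (simp add: W.lincomb_def)
  next
    case (insert b B)
    have b: "b \<in> carrier_mat n n" using insert.prems closed(1) by auto
    have "W.lincomb a (insert b B) = a b \<cdot>\<^sub>m b + W.lincomb a B"
      unfolding W.lincomb_def using insert.hyps insert.prems closed(3)
      by (subst W.finsum_insert) (auto simp: module_mat_simps)
    then show ?case using insert b by (intro eq_matI) auto
  qed
  have bound: "finite A \<and> card A \<le> d"
    if A: "A \<subseteq> carrier ?W \<and> W.lin_indpt A" for A
  proof (rule ccontr)
    assume "\<not> (finite A \<and> card A \<le> d)"
    then obtain B where B: "B \<subseteq> A" "finite B" "card B = Suc d"
      by (metis infinite_arbitrarily_large not_less_eq_eq obtain_subset_with_card_n)
    have BW: "B \<subseteq> W" using A B(1) by auto
    from d obtain L where L: "finite L" "card L \<le> d" "\<And>l. l \<in> L \<Longrightarrow> functional l"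
      "\<And>A i j. A \<in> entries n W \<Longrightarrow> (\<And>l. l \<in> L \<Longrightarrow> l A = 0) \<Longrightarrow> i < n \<Longrightarrow> j < n \<Longrightarrow> A i j = 0"
      by (rule dim_leE) metis
    have "card L < card B" using L(2) B(3) by simp
    from linear_dependency[OF L(1) B(2) this, of "\<lambda>l b. l (\<lambda>i j. b $$ (i, j))"]
    obtain a where a: "\<exists>b\<in>B. a b \<noteq> 0" "\<And>l. l \<in> L \<Longrightarrow> (\<Sum>b\<in>B. a b * l (\<lambda>i j. b $$ (i, j))) = 0"
      by auto
    define C where "C = (\<lambda>i j. \<Sum>b\<in>B. a b * b $$ (i, j))"
    have comb: "W.lincomb a B = mat n n (\<lambda>(i, j). C i j)"
      unfolding lincomb[OF B(2) BW] C_def by (intro eq_matI) auto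
    have "W.lincomb a B \<in> carrier ?W" using BW by (intro W.lincomb_closed) auto
    then have "C \<in> entries n W" by (simp add: comb entries_def)
    moreover have "l C = 0" if "l \<in> L" for l
      unfolding C_def functional_sum[OF L(3)[OF that] B(2)] by (rule a(2)[OF that])
    ultimately have "C i j = 0" if "i < n" "j < n" for i j using L(4) that by blast
    then have "W.lincomb a B = \<zero>\<^bsub>?W\<^esub>"
      unfolding comb by (intro eq_matI) (auto simp: module_mat_simps)
    then have "W.lin_dep A"
      unfolding W.lin_dep_def using B a(1) by (intro exI[of _ B] exI[of _ a]) auto
    then show False using A by simp
  qed
  have "W.lin_indpt {}" by (auto simp: W.lin_dep_def)
  then obtain G where G: "finite G" "maximal G (\<lambda>S. S \<subseteq> carrier ?W \<and> W.lin_indpt S)"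
    using maximal_exists[where B = "{}" and N = d and P = "\<lambda>S. S \<subseteq> carrier ?W \<and> W.lin_indpt S"]
      bound by auto
  have basis: "W.basis G" by (rule W.max_li_is_basis[OF G(2)])
  have GW: "G \<subseteq> W" using basis by (simp add: W.basis_def)
  show thesis
  proof (rule that[OF G(1) GW])
    show "card G = mat_subspace_dim n W"
      unfolding mat_subspace_dim_def using W.dim_basis[OF G(1) basis] by simp
    show "card G \<le> d" using G(2) bound by (auto simp: maximal_def)
    fix M assume "M \<in> W"
    then have "M \<in> W.span G" using basis by (simp add: W.basis_def)
    then obtain c where "M = W.lincomb c G" using W.finite_span[OF G(1)] GW by auto
    then show "\<exists>c. M = mat n n (\<lambda>p. \<Sum>g\<in>G. c g * g $$ p)" using lincomb[OF G(1) GW] by auto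
  qed
qed

lemma dim_le_square: "dim_le n W (n * n)"
proof (rule dim_leI[where L = "(\<lambda>(i, j) A. A i j) ` ({..<n} \<times> {..<n})"])
  show "card ((\<lambda>(i, j) (A :: nat \<Rightarrow> nat \<Rightarrow> 'a). A i j) ` ({..<n} \<times> {..<n})) \<le> n * n"
    using card_image_le[of "{..<n} \<times> {..<n}" "\<lambda>(i, j) (A :: nat \<Rightarrow> nat \<Rightarrow> 'a). A i j"]
    by (simp add: card_cartesian_product)
  fix A i j assume "\<And>l. l \<in> (\<lambda>(i, j) A. A i j) ` ({..<n} \<times> {..<n}) \<Longrightarrow> l A = 0" "i < n" "j < n"
  from this(1)[of "\<lambda>A. A i j"] this(2,3) show "A i j = 0" by force
qed (auto simp: functional_def lin2_def)

lemma mat_subspace_T_mat: "mat_subspace n (T_mat n :: 'a::field mat set)"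
  unfolding mat_subspace_def subspace_def submodule_def
  using matrix_vs[of n n, where 'a = 'a]
  by (auto simp: vectorspace_def module_mat_simps T_mat_def upper_triangular_def)

lemma weakly_triangularizable_T_mat: "weakly_triangularizable n (T_mat n :: 'a::field mat set)"
  unfolding weakly_triangularizable_def triangularizable_def
  using mat_subspace_T_mat by (auto simp: T_mat_def intro: similar_mat_refl)

text \<open>Fewer than \<open>tri n\<close> generators would satisfy a common nontrivial linear relation among the entries on and
above the diagonal, but the matrix units do not.\<close>
lemma tri_le_dim_T_mat: "tri n \<le> mat_subspace_dim n (T_mat n :: 'a::field mat set)"
proof (rule ccontr)
  let ?T = "T_mat n :: 'a mat set"
  assume less: "\<not> ?thesis"
  obtain G where G: "finite G" "G \<subseteq> ?T" "card G = mat_subspace_dim n ?T"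
    "\<And>M. M \<in> ?T \<Longrightarrow> \<exists>c. M = mat n n (\<lambda>p. \<Sum>g\<in>G. c g * g $$ p)"
    using mat_subspace_basis[OF mat_subspace_T_mat dim_le_square] by metis
  define S where "S = upper_positions n"
  have S: "finite S" "card S = tri n"
    by (simp_all add: S_def finite_upper_positions card_upper_positions)
  obtain a where a: "\<exists>s\<in>S. a s \<noteq> 0" "\<And>g. g \<in> G \<Longrightarrow> (\<Sum>s\<in>S. a s * g $$ prod.swap s) = 0"
    using linear_dependency[OF G(1) S(1), of "\<lambda>g s. g $$ prod.swap s"] less G(3) S(2) by auto
  have all: "(\<Sum>s\<in>S. a s * M $$ prod.swap s) = 0" if MT: "M \<in> ?T" for M
  proof -
    obtain c where M: "M = mat n n (\<lambda>p. \<Sum>g\<in>G. c g * g $$ p)" using G(4)[OF MT] by blast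
    have "(\<Sum>s\<in>S. a s * M $$ prod.swap s) = (\<Sum>s\<in>S. \<Sum>g\<in>G. c g * (a s * g $$ prod.swap s))"
      unfolding M by (intro sum.cong) (auto simp: S_def upper_positions_def sum_distrib_left mult_ac)
    also have "\<dots> = (\<Sum>g\<in>G. \<Sum>s\<in>S. c g * (a s * g $$ prod.swap s))" by (rule sum.swap)
    also have "\<dots> = 0" by (simp add: sum_distrib_left[symmetric] a(2))
    finally show ?thesis .
  qed
  from a(1) obtain s where s: "s \<in> S" "a s \<noteq> 0" by auto
  define M where "M = mat n n (\<lambda>p. if p = prod.swap s then 1 else 0 :: 'a)"
  have "M \<in> ?T" using s(1) by (auto simp: M_def T_mat_def upper_triangular_def S_def upper_positions_def)
  then have "0 = (\<Sum>u\<in>S. a u * M $$ prod.swap u)" by (simp add: all)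
  also have "\<dots> = (\<Sum>u\<in>S. if u = s then a u else 0)"
  proof (rule sum.cong[OF refl])
    fix u assume "u \<in> S"
    then show "a u * M $$ prod.swap u = (if u = s then a u else 0)"
      by (cases u; cases s) (auto simp: S_def upper_positions_def M_def)
  qed
  finally have "(\<Sum>u\<in>S. if u = s then a u else 0) = 0" by simp
  then show False using s S(1) by simp
qed

lemma quad_free_triangularizable:
  fixes A :: "nat \<Rightarrow> nat \<Rightarrow> 'a::field"
  assumes "triangularizable (mat n n (\<lambda>(i, j). A i j))"
  shows "quad_free n A"
proof -
  let ?A = "mat n n (\<lambda>(i, j). A i j)"
  obtain B P Q where B: "upper_triangular B" and sim: "similar_mat_wit ?A B P Q"
    using assms unfolding triangularizable_def similar_mat_def by blast
  have "?A \<in> carrier_mat n n" by simp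
  from similar_mat_witD2[OF this sim] have w: "P * Q = 1\<^sub>m n" "Q * P = 1\<^sub>m n" "?A = P * B * Q"
    "B \<in> carrier_mat n n" "P \<in> carrier_mat n n" "Q \<in> carrier_mat n n" by auto
  define b p q where "b = (\<lambda>i j. B $$ (i, j))" "p = (\<lambda>i j. P $$ (i, j))" "q = (\<lambda>i j. Q $$ (i, j))"
  have mult: "(X * Y) $$ (i, j) = mm n (\<lambda>i j. X $$ (i, j)) (\<lambda>i j. Y $$ (i, j)) i j"
    if "X \<in> carrier_mat n n" "Y \<in> carrier_mat n n" "i < n" "j < n" for X Y :: "'a mat" and i j
    using that by (simp add: scalar_prod_def mm_def lessThan_atLeast0)
  have b: "quad_free n b"
    using B w(4) by (intro quad_free_upper_triangular) (auto simp: upper_triangular_def b_p_q_def)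
  have inv: "inv_pair n q p"
    unfolding inv_pair_def id_on_def b_p_q_def
    using mult[OF w(5,6)] mult[OF w(6,5)] w(1,2) by (metis index_one_mat(1))
  have "A i j = mm n p (mm n b q) i j" if "i < n" "j < n" for i j
  proof -
    have "A i j = ?A $$ (i, j)" using that by simp
    also have "\<dots> = (P * (B * Q)) $$ (i, j)"
      unfolding w(3) assoc_mult_mat[OF w(5,4,6)] ..
    also have "\<dots> = mm n p (\<lambda>i j. (B * Q) $$ (i, j)) i j"
      unfolding b_p_q_def using w(4-6) that by (intro mult) auto
    also have "\<dots> = mm n p (mm n b q) i j"
      using that mult[OF w(4,6)] by (intro mm_cong refl) (simp add: b_p_q_def)
    finally show ?thesis .
  qed
  then show ?thesis by (rule quad_free_conj[OF inv b])
qed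

lemma maximal_qf_entries:
  fixes W :: "'a::field mat set"
  assumes "optimal n W"
  shows "maximal_qf n (entries n W)"
proof -
  have wt: "weakly_triangularizable n W" and dim: "mat_subspace_dim n W = t_dim TYPE('a) n"
    using assms by (auto simp: optimal_def)
  then have sub: "mat_subspace n W" and tri: "\<And>A. A \<in> W \<Longrightarrow> triangularizable A"
    by (auto simp: weakly_triangularizable_def)
  have "qf_space n (entries n W)"
    using mspace_entries[OF sub] tri quad_free_triangularizable
    by (auto simp: qf_space_def entries_def)
  moreover have "tri n \<le> d" if "dim_le n (entries n W) d" for d
  proof -
    have "tri n \<le> mat_subspace_dim n (T_mat n :: 'a mat set)" by (rule tri_le_dim_T_mat)
    also have "\<dots> \<le> t_dim TYPE('a) n" by (rule t_dim_upper[OF weakly_triangularizable_T_mat])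
    also have "\<dots> \<le> d" using mat_subspace_basis[OF sub that] dim by metis
    finally show ?thesis .
  qed
  ultimately show ?thesis by (simp add: maximal_qf_def)
qed

theorem corollary1p4:
  fixes W :: "'a::field mat set" and n :: nat
  assumes "infinite (UNIV :: 'a set)"
    and "\<not> pythagorean TYPE('a)"
    and "n \<ge> 1"
    and "optimal n W"
  shows "conjugated n W (T_mat n)"
proof -
  let ?E = "entries n W"
  let ?m = "\<lambda>A. mat n n (\<lambda>(i, j). A i j :: 'a)"
  have sub: "W \<subseteq> carrier_mat n n"
    using assms(4) mat_subspace_closed(1) by (auto simp: optimal_def weakly_triangularizable_def)
  have max: "maximal_qf n ?E" by (rule maximal_qf_entries[OF assms(4)])
  obtain P P' where P: "inv_pair n P P'"
    and tri: "\<And>A i j. A \<in> ?E \<Longrightarrow> i < n \<Longrightarrow> j < i \<Longrightarrow> mm n P' (mm n A P) i j = 0"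
    using maximal_qf_triangular[OF assms(1,2) max] by blast
  define V where "V = conj_space n P P' ?E"
  have V: "B \<in> V" if "\<And>i j. i < n \<Longrightarrow> j < i \<Longrightarrow> B i j = 0" for B
  proof (rule maximal_qf_all_triangular[where W = V and n = n])
    show "maximal_qf n V" unfolding V_def by (rule maximal_qf_conj[OF P max])
    show "A i j = 0" if A: "A \<in> V" "i < n" "j < i" for A i j
    proof -
      obtain A' where "A' \<in> ?E" "\<forall>i<n. \<forall>j<n. A i j = mm n P' (mm n A' P) i j"
        using A(1) unfolding V_def conj_space_def by auto
      then show ?thesis using tri[of A' i j] A by simp
    qed
  qed (use assms(3) that in auto)
  have mult: "?m (mm n A B) = ?m A * ?m B" for A B
    by (intro eq_matI) (auto simp: scalar_prod_def mm_def lessThan_atLeast0)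
  have inv: "?m P * ?m P' = 1\<^sub>m n" "?m P' * ?m P = 1\<^sub>m n"
    unfolding mult[symmetric] using P by (auto simp: inv_pair_def id_on_def intro!: eq_matI)
  have "W = (\<lambda>A. ?m P * A * ?m P') ` T_mat n"
  proof
    show "W \<subseteq> (\<lambda>A. ?m P * A * ?m P') ` T_mat n"
    proof
      fix M assume M: "M \<in> W"
      define A where "A = (\<lambda>i j. M $$ (i, j))"
      have MA: "?m A = M" using M sub by (intro eq_matI) (auto simp: A_def)
      then have "A \<in> ?E" using M by (simp add: entries_def)
      then have "?m (mm n P' (mm n A P)) \<in> T_mat n"
        using tri by (auto simp: T_mat_def upper_triangular_def)
      moreover have "?m P * ?m (mm n P' (mm n A P)) * ?m P' = M"
      proof -
        have "?m P * ?m (mm n P' (mm n A P)) * ?m P' = ?m (mm n P (mm n (mm n P' (mm n A P)) P'))"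
          by (simp only: mult[symmetric] mm_assoc)
        also have "\<dots> = ?m A" by (intro eq_matI) (auto simp: conj_back[OF P])
        finally show ?thesis by (simp only: MA)
      qed
      ultimately show "M \<in> (\<lambda>A. ?m P * A * ?m P') ` T_mat n" by (metis image_eqI)
    qed
    show "(\<lambda>A. ?m P * A * ?m P') ` T_mat n \<subseteq> W"
    proof (rule image_subsetI)
      fix T :: "'a mat" assume T: "T \<in> T_mat n"
      define B where "B = (\<lambda>i j. T $$ (i, j))"
      have TB: "?m B = T" using T by (intro eq_matI) (auto simp: B_def T_mat_def)
      have "B \<in> V" using T by (intro V) (auto simp: B_def T_mat_def upper_triangular_def)
      then obtain A where A: "A \<in> ?E" "\<And>i j. i < n \<Longrightarrow> j < n \<Longrightarrow> B i j = mm n P' (mm n A P) i j"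
        unfolding V_def conj_space_def by auto
      have "?m P * T * ?m P' = ?m (mm n P (mm n B P'))"
        unfolding TB[symmetric] by (simp only: mult[symmetric] mm_assoc)
      also have "\<dots> = ?m A"
      proof (intro eq_matI)
        fix i j assume "i < dim_row (?m A)" "j < dim_col (?m A)"
        then have ij: "i < n" "j < n" by auto
        have "mm n P (mm n B P') i j = mm n P (mm n (mm n P' (mm n A P)) P') i j"
          using ij by (intro mm_cong refl) (auto simp: A(2))
        then show "?m (mm n P (mm n B P')) $$ (i, j) = ?m A $$ (i, j)"
          using ij conj_back[OF P ij, of A] by simp
      qed auto
      finally show "?m P * T * ?m P' \<in> W" using A(1) by (simp add: entries_def)
    qed
  qed
  then show ?thesis
    unfolding conjugated_def using inv by (intro exI[of _ "?m P"] exI[of _ "?m P'"]) auto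
qed

end
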